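(* Let $\mathcal{H}$ be a separable complex Hilbert space and let $A$ be a bounded noncompact operator on $\mathcal{H}$. Then the operator $T:\mathcal{H}\oplus\mathcal{H}\to\mathcal{H}\oplus\mathcal{H}$ defined by $$T=\begin{pmatrix}0&A\\0&0\end{pmatrix}$$ is a complex symmetric operator which is not unitarily equivalent to a truncated Toeplitz operator with continuous symbol; that is, there are no nonconstant inner function $u$ and $\varphi\in C(\mathbb{T})$ such that $T$ is unitarily equivalent to $A_\varphi^u$.
   Context: A bounded operator $T$ on a Hilbert space $\mathcal{H}$ is called complex symmetric if there is a conjugate-linear, isometric involution $J$ on $\mathcal{H}$ with $T=JT^*J$. $\mathbb{T}$ is the unit circle, $H^2$ the classical Hardy space, viewed as a subspace of $L^2=L^2(\mathbb{T})$. For a nonconstant inner function $u$, $\mathcal{K}_u:=H^2\ominus uH^2$, $P_u$ is the orthogonal projection of $L^2$ onto $\mathcal{K}_u$, and for $\varphi\in L^\infty(\mathbb{T})$ the truncated Toeplitz operator with symbol $\varphi$ is $A_\varphi^u:\mathcal{K}_u\to\mathcal{K}_u$, $A_\varphi^u f=P_u(\varphi f)$. *)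

theory Defs
  imports "HOL-Analysis.Analysis"
begin

section \<open>Complex Hilbert spaces\<close>

text \<open>A complex inner product space is a real one whose inner product is the real part of a
  sesquilinear form (linear in the first argument). Norm, topology and completeness are the ones
  of \<^class>\<open>real_inner\<close>.\<close>

class complex_inner = real_inner +
  fixes scaleC :: "complex \<Rightarrow> 'a \<Rightarrow> 'a" (infixr \<open>*\<^sub>C\<close> 75)
    and cinner :: "'a \<Rightarrow> 'a \<Rightarrow> complex"
  assumes scaleC_add_right: "c *\<^sub>C (x + y) = c *\<^sub>C x + c *\<^sub>C y"
    and scaleC_add_left: "(c + d) *\<^sub>C x = c *\<^sub>C x + d *\<^sub>C x"
    and scaleC_scaleC: "c *\<^sub>C d *\<^sub>C x = (c * d) *\<^sub>C x"
    and scaleC_of_real: "complex_of_real r *\<^sub>C x = r *\<^sub>R x"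
    and cinner_commute: "cinner x y = cnj (cinner y x)"
    and cinner_add_left: "cinner (x + y) z = cinner x z + cinner y z"
    and cinner_scaleC_left: "cinner (c *\<^sub>C x) y = c * cinner x y"
    and Re_cinner: "Re (cinner x y) = inner x y"

class complex_hilbert = complex_inner + complete_space

lemma cinner_self: "cinner x x = complex_of_real ((norm x)\<^sup>2)"
proof -
  have "Im (cinner x x) = 0"
    using cinner_commute[of x x] by (simp add: complex_eq_iff)
  then show ?thesis
    by (simp add: complex_eq_iff Re_cinner power2_norm_eq_inner)
qed

instantiation prod :: (complex_inner, complex_inner) complex_inner
begin

definition "c *\<^sub>C p = (c *\<^sub>C fst p, c *\<^sub>C snd p)"
definition "cinner p q = cinner (fst p) (fst q) + cinner (snd p) (snd q)"

instance
proof
  fix x y :: "'a \<times> 'b"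
  show "cinner x y = cnj (cinner y x)"
    unfolding cinner_prod_def complex_cnj_add by (metis cinner_commute)
qed (simp_all add: scaleC_prod_def cinner_prod_def scaleC_add_right scaleC_add_left scaleC_scaleC
      scaleC_of_real cinner_add_left cinner_scaleC_left Re_cinner inner_prod_def prod_eq_iff
      algebra_simps)

end

instance prod :: (complex_hilbert, complex_hilbert) complex_hilbert ..


section \<open>Operators\<close>

definition bounded_clinear :: "('a::complex_inner \<Rightarrow> 'b::complex_inner) \<Rightarrow> bool" where
  "bounded_clinear T \<longleftrightarrow> bounded_linear T \<and> (\<forall>c x. T (c *\<^sub>C x) = c *\<^sub>C T x)"

definition compact_operator :: "('a::complex_inner \<Rightarrow> 'b::complex_inner) \<Rightarrow> bool" where
  "compact_operator T \<longleftrightarrow> bounded_clinear T \<and> compact (closure (T ` cball 0 1))"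

definition cadjoint :: "('a::complex_inner \<Rightarrow> 'b::complex_inner) \<Rightarrow> 'b \<Rightarrow> 'a" where
  "cadjoint T = (THE S. \<forall>x y. cinner (T x) y = cinner x (S y))"

definition conjugation :: "('a::complex_inner \<Rightarrow> 'a) \<Rightarrow> bool" where
  "conjugation J \<longleftrightarrow>
     (\<forall>x y. J (x + y) = J x + J y) \<and> (\<forall>c x. J (c *\<^sub>C x) = cnj c *\<^sub>C J x) \<and>
     (\<forall>x. norm (J x) = norm x) \<and> (\<forall>x. J (J x) = x)"

definition complex_symmetric :: "('a::complex_hilbert \<Rightarrow> 'a) \<Rightarrow> bool" where
  "complex_symmetric T \<longleftrightarrow>
     bounded_clinear T \<and> (\<exists>J. conjugation J \<and> T = J \<circ> cadjoint T \<circ> J)"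

text \<open>Unitary equivalence of an operator on a space with an operator on a linear subspace
  \<open>M\<close> of another one.\<close>

definition unitary_onto :: "('a::complex_inner \<Rightarrow> 'b::complex_inner) \<Rightarrow> 'b set \<Rightarrow> bool" where
  "unitary_onto U M \<longleftrightarrow> bounded_clinear U \<and> (\<forall>x y. cinner (U x) (U y) = cinner x y) \<and> range U = M"

definition unitarily_equivalent_on ::
    "('a::complex_inner \<Rightarrow> 'a) \<Rightarrow> 'b::complex_inner set \<Rightarrow> ('b \<Rightarrow> 'b) \<Rightarrow> bool" where
  "unitarily_equivalent_on T M S \<longleftrightarrow> (\<exists>U. unitary_onto U M \<and> (\<forall>x. U (T x) = S (U x)))"

definition orth_proj :: "'a::complex_inner set \<Rightarrow> 'a \<Rightarrow> 'a" where
  "orth_proj M x = (THE y. y \<in> M \<and> (\<forall>z\<in>M. cinner (x - y) z = 0))"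


section \<open>The space $L^2$ of the unit circle\<close>

text \<open>Normalized arc length. Its space is the unit circle itself, so that measurability and
  integrability do not depend on values off the circle.\<close>

definition circle :: "complex measure" where
  "circle = distr (uniform_measure lborel {0..<2 * pi}) (restrict_space borel (sphere 0 1)) cis"

lemma cis_measurable_circle:
  "cis \<in> uniform_measure lborel {0..<2 * pi} \<rightarrow>\<^sub>M restrict_space borel (sphere 0 1)"
proof -
  have "cis \<in> borel_measurable borel"
    by (intro borel_measurable_continuous_onI continuous_intros)
  then show ?thesis
    by (intro measurable_restrict_space2) auto
qed

lemma space_circle [simp]: "space circle = sphere 0 1"
  by (simp add: circle_def space_restrict_space)

lemma sets_circle: "sets circle = sets (restrict_space borel (sphere 0 1))"
  by (simp add: circle_def)

lemma emeasure_circle: "emeasure circle (space circle) = 1"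
proof -
  have "cis -` sphere 0 1 = UNIV"
    by auto
  moreover have "sphere 0 1 \<in> sets (restrict_space borel (sphere (0::complex) 1))"
    by (simp add: sets_restrict_space_iff)
  moreover have "emeasure (uniform_measure lborel {0..<2 * pi}) UNIV = 1"
    by (simp add: divide_ennreal)
  ultimately show ?thesis
    unfolding space_circle unfolding circle_def
    by (subst emeasure_distr[OF cis_measurable_circle]) simp_all
qed

interpretation circle: finite_measure circle
  by (rule finite_measureI) (simp add: emeasure_circle del: space_circle)

lemma continuous_on_measurable_circle:
  "continuous_on (sphere 0 1) f \<Longrightarrow> f \<in> borel_measurable circle"
  using borel_measurable_continuous_on_restrict measurable_cong_sets[OF sets_circle refl] by blast

definition sq_integrable :: "(complex \<Rightarrow> complex) \<Rightarrow> bool" where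
  "sq_integrable f \<longleftrightarrow> f \<in> borel_measurable circle \<and> integrable circle (\<lambda>z. (cmod (f z))\<^sup>2)"

lemma sq_integrable_measurable [measurable_dest]:
  "sq_integrable f \<Longrightarrow> f \<in> borel_measurable circle"
  by (simp add: sq_integrable_def)

lemma sq_integrable_add:
  assumes "sq_integrable f" "sq_integrable g"
  shows "sq_integrable (\<lambda>z. f z + g z)"
proof -
  have "integrable circle (\<lambda>z. (cmod (f z + g z))\<^sup>2)"
  proof (rule Bochner_Integration.integrable_bound)
    show "integrable circle (\<lambda>z. 2 * (cmod (f z))\<^sup>2 + 2 * (cmod (g z))\<^sup>2)"
      using assms by (auto simp: sq_integrable_def)
    have "(cmod (f z + g z))\<^sup>2 \<le> 2 * (cmod (f z))\<^sup>2 + 2 * (cmod (g z))\<^sup>2" for z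
    proof -
      have "(cmod (f z + g z))\<^sup>2 \<le> (cmod (f z) + cmod (g z))\<^sup>2"
        by (intro power_mono norm_triangle_ineq) auto
      also have "\<dots> \<le> 2 * (cmod (f z))\<^sup>2 + 2 * (cmod (g z))\<^sup>2"
        using zero_le_power2[of "cmod (f z) - cmod (g z)"]
        by (simp add: power2_sum power2_diff)
      finally show ?thesis .
    qed
    then show "AE z in circle. norm ((cmod (f z + g z))\<^sup>2)
        \<le> norm (2 * (cmod (f z))\<^sup>2 + 2 * (cmod (g z))\<^sup>2)"
      by (simp add: abs_of_nonneg)
  qed (use assms in \<open>auto simp: sq_integrable_def\<close>)
  then show ?thesis
    using assms by (auto simp: sq_integrable_def)
qed

lemma sq_integrable_scale: "sq_integrable f \<Longrightarrow> sq_integrable (\<lambda>z. c * f z)"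
  by (auto simp: sq_integrable_def norm_mult power_mult_distrib)

lemma sq_integrable_0: "sq_integrable (\<lambda>z. 0)"
  by (simp add: sq_integrable_def)

lemma integrable_mult_cnj:
  assumes "sq_integrable f" "sq_integrable g"
  shows "integrable circle (\<lambda>z. f z * cnj (g z))"
proof (rule Bochner_Integration.integrable_bound)
  show "integrable circle (\<lambda>z. (cmod (f z))\<^sup>2 + (cmod (g z))\<^sup>2)"
    using assms by (auto simp: sq_integrable_def)
  have [measurable]: "f \<in> borel_measurable circle" "g \<in> borel_measurable circle"
    using assms by (auto simp: sq_integrable_def)
  show "(\<lambda>z. f z * cnj (g z)) \<in> borel_measurable circle"
    by (intro borel_measurable_times borel_measurable_continuous_on[where f = cnj])
      (auto intro: continuous_intros)
  have "cmod (f z) * cmod (g z) \<le> (cmod (f z))\<^sup>2 + (cmod (g z))\<^sup>2" for z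
    using zero_le_power2[of "cmod (f z) - cmod (g z)"]
      mult_nonneg_nonneg[OF norm_ge_zero[of "f z"] norm_ge_zero[of "g z"]]
    unfolding power2_diff by linarith
  then show "AE z in circle. norm (f z * cnj (g z)) \<le> norm ((cmod (f z))\<^sup>2 + (cmod (g z))\<^sup>2)"
    by (simp add: norm_mult abs_of_nonneg)
qed

definition L2_rel :: "(complex \<Rightarrow> complex) \<Rightarrow> (complex \<Rightarrow> complex) \<Rightarrow> bool" where
  "L2_rel f g \<longleftrightarrow> sq_integrable f \<and> sq_integrable g \<and> (AE z in circle. f z = g z)"

lemma part_equivp_L2_rel: "part_equivp L2_rel"
proof (rule part_equivpI)
  show "\<exists>f. L2_rel f f"
    using sq_integrable_0 by (auto simp: L2_rel_def)
  show "symp L2_rel"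
    by (auto simp: symp_def L2_rel_def elim: eventually_mono)
  show "transp L2_rel"
    by (auto simp: transp_def L2_rel_def elim: eventually_elim2)
qed

quotient_type L2 = "complex \<Rightarrow> complex" / partial: L2_rel
  by (rule part_equivp_L2_rel)

instantiation L2 :: complex_inner
begin

lift_definition zero_L2 :: L2 is "\<lambda>z. 0"
  by (simp add: L2_rel_def sq_integrable_0)

lift_definition plus_L2 :: "L2 \<Rightarrow> L2 \<Rightarrow> L2" is "\<lambda>f g z. f z + g z"
  by (auto simp: L2_rel_def sq_integrable_add elim: eventually_elim2)

lift_definition scaleC_L2 :: "complex \<Rightarrow> L2 \<Rightarrow> L2" is "\<lambda>c f z. c * f z"
  by (auto simp: L2_rel_def sq_integrable_scale elim: eventually_mono)

lift_definition cinner_L2 :: "L2 \<Rightarrow> L2 \<Rightarrow> complex" is "\<lambda>f g. \<integral>z. f z * cnj (g z) \<partial>circle"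
proof -
  fix f f' g g' assume *: "L2_rel f f'" "L2_rel g g'"
  show "(\<integral>z. f z * cnj (g z) \<partial>circle) = (\<integral>z. f' z * cnj (g' z) \<partial>circle)"
  proof (rule integral_cong_AE)
    show "(\<lambda>z. f z * cnj (g z)) \<in> borel_measurable circle"
      "(\<lambda>z. f' z * cnj (g' z)) \<in> borel_measurable circle"
      using * by (auto simp: L2_rel_def intro!: borel_measurable_integrable integrable_mult_cnj)
    show "AE z in circle. f z * cnj (g z) = f' z * cnj (g' z)"
      using * by (auto simp: L2_rel_def elim: eventually_elim2)
  qed
qed

definition "(- f :: L2) = (-1) *\<^sub>C f"
definition "(f - g :: L2) = f + - g"
definition "r *\<^sub>R (f :: L2) = complex_of_real r *\<^sub>C f"
definition "inner (f :: L2) g = Re (cinner f g)"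
definition "norm (f :: L2) = sqrt (inner f f)"
definition "sgn (f :: L2) = inverse (norm f) *\<^sub>R f"
definition "dist (f :: L2) g = norm (f - g)"
definition "(uniformity :: (L2 \<times> L2) filter) = (INF e\<in>{0<..}. principal {(f, g). dist f g < e})"
definition "open (S :: L2 set) \<longleftrightarrow> (\<forall>f\<in>S. \<forall>\<^sub>F (f', g) in uniformity. f' = f \<longrightarrow> g \<in> S)"

instance
proof
  fix f g h :: L2 and a b :: real and c d :: complex
  show "f + g + h = f + (g + h)"
    by transfer (auto simp: L2_rel_def sq_integrable_add algebra_simps)
  show "f + g = g + f"
    by transfer (auto simp: L2_rel_def sq_integrable_add algebra_simps)
  show "0 + f = f"
    by transfer (auto simp: L2_rel_def)
  show "- f + f = 0"
    unfolding uminus_L2_def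
    by transfer (simp add: L2_rel_def sq_integrable_0)
  show "f - g = f + - g"
    by (rule minus_L2_def)
  show scaleC1: "c *\<^sub>C (f + g) = c *\<^sub>C f + c *\<^sub>C g" for c :: complex and f g :: L2
    by transfer (auto simp: L2_rel_def sq_integrable_add sq_integrable_scale distrib_left)
  show scaleC2: "(c + d) *\<^sub>C f = c *\<^sub>C f + d *\<^sub>C f" for c d :: complex and f :: L2
    by transfer (auto simp: L2_rel_def sq_integrable_add sq_integrable_scale distrib_right)
  show scaleC3: "c *\<^sub>C d *\<^sub>C f = (c * d) *\<^sub>C f" for c d :: complex and f :: L2
    by transfer (auto simp: L2_rel_def sq_integrable_scale mult.assoc)
  show "complex_of_real a *\<^sub>C f = a *\<^sub>R f"
    by (simp add: scaleR_L2_def)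
  show "a *\<^sub>R (f + g) = a *\<^sub>R f + a *\<^sub>R g" "(a + b) *\<^sub>R f = a *\<^sub>R f + b *\<^sub>R f"
    "a *\<^sub>R b *\<^sub>R f = (a * b) *\<^sub>R f"
    by (simp_all add: scaleR_L2_def scaleC1 scaleC2 scaleC3)
  show "1 *\<^sub>R f = f"
    unfolding scaleR_L2_def by transfer (auto simp: L2_rel_def)
  show cinner1: "cinner f g = cnj (cinner g f)" for f g :: L2
    by transfer (simp add: Bochner_Integration.integral_cnj[symmetric] mult.commute)
  show cinner2: "cinner (f + g) h = cinner f h + cinner g h"
    by transfer (auto simp: L2_rel_def distrib_right integrable_mult_cnj
        intro!: Bochner_Integration.integral_add)
  show cinner3: "cinner (c *\<^sub>C f) g = c * cinner f g" for c :: complex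
    by transfer (simp add: mult.assoc)
  show "Re (cinner f g) = inner f g"
    by (simp add: inner_L2_def)
  show "inner f g = inner g f"
    unfolding inner_L2_def by (subst cinner1) simp
  show "inner (f + g) h = inner f h + inner g h"
    by (simp add: inner_L2_def cinner2)
  show "inner (a *\<^sub>R f) g = a * inner f g"
    by (simp add: inner_L2_def scaleR_L2_def cinner3)
  have self: "Re (\<integral>z. f z * cnj (f z) \<partial>circle) = (\<integral>z. (cmod (f z))\<^sup>2 \<partial>circle)" for f
    by (simp add: complex_norm_square[symmetric] del: of_real_power)
  show "0 \<le> inner f f"
    unfolding inner_L2_def by transfer (simp add: self)
  show "(inner f f = 0) = (f = 0)"
    unfolding inner_L2_def
    by transfer (auto simp: self L2_rel_def sq_integrable_0 integral_nonneg_eq_0_iff_AE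
        sq_integrable_def)
qed (fact norm_L2_def sgn_L2_def dist_L2_def uniformity_L2_def open_L2_def)+

end

text \<open>The class of a function in $L^2$; by convention zero for other functions.\<close>

lift_definition L2_class :: "(complex \<Rightarrow> complex) \<Rightarrow> L2" is
  "\<lambda>f. if sq_integrable f then f else (\<lambda>z. 0)"
  by (auto simp: L2_rel_def sq_integrable_0)


section \<open>Truncated Toeplitz operators\<close>

definition Linfty :: "(complex \<Rightarrow> complex) set" where
  "Linfty = {\<phi>. \<phi> \<in> borel_measurable circle \<and> (\<exists>C. AE z in circle. cmod (\<phi> z) \<le> C)}"

lemma sq_integrable_Linfty_mult:
  assumes "\<phi> \<in> Linfty" "sq_integrable f"
  shows "sq_integrable (\<lambda>z. \<phi> z * f z)"
proof -
  obtain C where C: "AE z in circle. cmod (\<phi> z) \<le> C"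
    using assms by (auto simp: Linfty_def)
  have [measurable]: "\<phi> \<in> borel_measurable circle" "f \<in> borel_measurable circle"
    using assms by (auto simp: Linfty_def sq_integrable_def)
  have "integrable circle (\<lambda>z. (cmod (\<phi> z * f z))\<^sup>2)"
  proof (rule Bochner_Integration.integrable_bound)
    show "integrable circle (\<lambda>z. C\<^sup>2 * (cmod (f z))\<^sup>2)"
      using assms by (auto simp: sq_integrable_def)
    show "AE z in circle. norm ((cmod (\<phi> z * f z))\<^sup>2) \<le> norm (C\<^sup>2 * (cmod (f z))\<^sup>2)"
      using C by eventually_elim
        (auto simp: norm_mult power_mult_distrib intro!: mult_right_mono power_mono)
  qed measurable
  then show ?thesis
    by (simp add: sq_integrable_def)
qed

lemma continuous_on_Linfty:
  assumes "continuous_on (sphere 0 1) \<phi>"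
  shows "\<phi> \<in> Linfty"
proof -
  have "bounded (\<phi> ` sphere 0 1)"
    by (intro compact_imp_bounded compact_continuous_image assms compact_sphere)
  then obtain C where "\<forall>z\<in>sphere 0 1. cmod (\<phi> z) \<le> C"
    by (auto simp: bounded_iff)
  then have "AE z in circle. cmod (\<phi> z) \<le> C"
    by (intro AE_I2) simp
  then show ?thesis
    using continuous_on_measurable_circle[OF assms] by (auto simp: Linfty_def)
qed

text \<open>Multiplication by a symbol in $L^\infty$; by convention zero for other symbols.\<close>

lift_definition L2_mult :: "(complex \<Rightarrow> complex) \<Rightarrow> L2 \<Rightarrow> L2" is
  "\<lambda>\<phi> f. if \<phi> \<in> Linfty then (\<lambda>z. \<phi> z * f z) else (\<lambda>z. 0)"
  by (auto simp: L2_rel_def sq_integrable_Linfty_mult sq_integrable_0 elim: eventually_mono)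

text \<open>The Hardy space as a subspace of $L^2$: all Fourier coefficients of negative index vanish.\<close>

definition H2 :: "L2 set" where
  "H2 = {f. \<forall>n<0. cinner f (L2_class (\<lambda>z. z powi n)) = 0}"

text \<open>Inner functions are represented by their boundary functions.\<close>

definition inner_function :: "(complex \<Rightarrow> complex) \<Rightarrow> bool" where
  "inner_function u \<longleftrightarrow>
     u \<in> borel_measurable circle \<and> (AE z in circle. cmod (u z) = 1) \<and> L2_class u \<in> H2"

definition nonconstant :: "(complex \<Rightarrow> complex) \<Rightarrow> bool" where
  "nonconstant u \<longleftrightarrow> \<not> (\<exists>c. AE z in circle. u z = c)"

definition model_space :: "(complex \<Rightarrow> complex) \<Rightarrow> L2 set" where
  "model_space u = {f \<in> H2. \<forall>g \<in> L2_mult u ` H2. cinner f g = 0}"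

definition truncated_Toeplitz :: "(complex \<Rightarrow> complex) \<Rightarrow> (complex \<Rightarrow> complex) \<Rightarrow> L2 \<Rightarrow> L2" where
  "truncated_Toeplitz u \<phi> f = orth_proj (model_space u) (L2_mult \<phi> f)"

end

theory Submission
  imports Defs
begin

text \<open>
  Complex symmetry: polar decomposition gives \<open>A = V S\<close> with \<open>S\<close> self-adjoint and \<open>V\<close> a partial
  isometry, and there is a conjugation \<open>K\<close> commuting with \<open>S\<close>. The antiunitary \<open>V K\<close> is then used to
  exchange the two summands of \<open>H \<oplus> H\<close>.

  Noncompactness: if \<open>q\<close> is a polynomial in \<open>z\<close> and \<open>cnj z\<close>, multiplication by \<open>q\<close> maps a subspace of
  finite codimension of the model space into the model space. Approximate \<open>cnj \<phi>\<close> uniformly by such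
  \<open>q\<close>. For \<open>f\<close> corresponding to \<open>(0, y)\<close>, the adjoint of the Toeplitz operator annihilates \<open>f\<close>, that is,
  \<open>cnj \<phi> f\<close> is orthogonal to the model space; as \<open>q f\<close> lies in it for \<open>y\<close> in a subspace of finite
  codimension, \<open>cnj \<phi> f\<close> is small, hence so are \<open>\<phi> f\<close>, its projection, and \<open>A y\<close>. So \<open>A\<close> is compact.
\<close>

section \<open>Projections and adjoints in complex Hilbert spaces\<close>

text \<open>The obstruction is essential normality: truncated Toeplitz operators with continuous
  symbol are normal modulo compact operators, whereas T* T - T T* has the diagonal blocks - A A* and
  A* A, which are compact only for compact A. No commutator is computed; instead this is tested on
  the vectors (0, y), which T* annihilates and on which T acts as A. Passing from cnj \<phi> f to
  \<phi> f is possible because multiplication operators on all of L^2, before truncation, are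
  normal. The finite codimension has a concrete source: for f in the model space, z f stays there
  once f is orthogonal to the single function cnj z * u, and cnj z * f stays there once f is
  orthogonal to 1. For the symmetry, spectral theory would supply the square root, the partial
  isometry and K. Their places are taken by a norm-convergent iteration, the projection onto a
  closed graph, and Zorn's lemma.\<close>

instance complex_hilbert \<subseteq> banach ..

section \<open>Algebra and continuity of the complex inner product\<close>

lemma cinner_add_right: "cinner x (y + z) = cinner x y + cinner x z"
  by (metis cinner_commute cinner_add_left complex_cnj_add)

lemma cinner_scaleC_right: "cinner x (c *\<^sub>C y) = cnj c * cinner x y"
  by (metis cinner_commute cinner_scaleC_left complex_cnj_mult)

lemma scaleC_minus1: "(- 1) *\<^sub>C x = - x"
  using scaleC_of_real[of "-1" x] by simp

lemma cinner_minus_left: "cinner (- x) y = - cinner x y"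
  by (metis cinner_scaleC_left scaleC_minus1 mult_minus1)

lemma cinner_minus_right: "cinner x (- y) = - cinner x y"
  by (metis cinner_commute cinner_minus_left complex_cnj_minus)

lemma cinner_diff_left: "cinner (x - y) z = cinner x z - cinner y z"
  using cinner_add_left[of x "- y" z] by (simp add: cinner_minus_left)

lemma cinner_diff_right: "cinner x (y - z) = cinner x y - cinner x z"
  using cinner_add_right[of x y "- z"] by (simp add: cinner_minus_right)

lemma cinner_zero_left [simp]: "cinner 0 x = 0"
  using cinner_diff_left[of x x x] by simp

lemma cinner_zero_right [simp]: "cinner x 0 = 0"
  using cinner_diff_right[of x x x] by simp

lemma cinner_scaleR_left: "cinner (r *\<^sub>R x) y = of_real r * cinner x y"
  by (simp flip: scaleC_of_real add: cinner_scaleC_left)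

lemma cinner_scaleR_right: "cinner x (r *\<^sub>R y) = of_real r * cinner x y"
  by (simp flip: scaleC_of_real add: cinner_scaleC_right)

lemmas cinner_simps = cinner_add_left cinner_add_right cinner_diff_left cinner_diff_right
  cinner_minus_left cinner_minus_right cinner_scaleC_left cinner_scaleC_right
  cinner_scaleR_left cinner_scaleR_right

lemma cinner_sum_left: "cinner (\<Sum>i\<in>I. f i) y = (\<Sum>i\<in>I. cinner (f i) y)"
  by (induction I rule: infinite_finite_induct) (auto simp: cinner_simps)

lemma cinner_eqI: "(\<And>z. cinner x z = cinner y z) \<Longrightarrow> x = y"
  by (metis cinner_diff_left Re_cinner eq_iff_diff_eq_0 inner_eq_zero_iff zero_complex.simps(1))

lemma cinner_eqI_right: "(\<And>z. cinner z x = cinner z y) \<Longrightarrow> x = y"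
  by (metis cinner_commute cinner_eqI)

lemma norm_scaleC: "norm (c *\<^sub>C x) = cmod c * norm x"
proof -
  have "complex_of_real ((norm (c *\<^sub>C x))\<^sup>2) = complex_of_real ((cmod c * norm x)\<^sup>2)"
    unfolding cinner_self[symmetric] cinner_scaleC_left cinner_scaleC_right
    by (simp add: cinner_self power_mult_distrib complex_norm_square del: of_real_power)
  then have "(norm (c *\<^sub>C x))\<^sup>2 = (cmod c * norm x)\<^sup>2"
    by (simp only: of_real_eq_iff)
  then show ?thesis
    by (simp add: power2_eq_iff_nonneg)
qed

lemma Im_cinner: "Im (cinner x y) = inner x (\<i> *\<^sub>C y)"
  by (simp flip: Re_cinner add: cinner_scaleC_right)

lemma cinner_bound: "cmod (cinner x y) \<le> norm x * norm y"
proof (cases "cinner x y = 0")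
  case False
  \<comment> \<open>Rotating y by this unimodular factor makes the inner product real and
    nonnegative, which reduces the claim to the real Cauchy-Schwarz inequality.\<close>
  define c where "c = cinner x y / cmod (cinner x y)"
  have c: "cmod c = 1"
    using False by (simp add: c_def norm_divide)
  have "inner x (c *\<^sub>C y) = cmod (cinner x y)"
    using False by (simp flip: Re_cinner complex_norm_square
      add: cinner_scaleC_right c_def mult.commute[of "cnj _"] power2_eq_square)
  then show ?thesis
    using norm_cauchy_schwarz[of x "c *\<^sub>C y"] by (simp add: norm_scaleC c)
qed simp

lemma bounded_linear_scaleC: "bounded_linear (\<lambda>x. c *\<^sub>C x)"
proof (rule bounded_linear_intro[where K = "cmod c"])
  fix r and x :: 'a
  show "c *\<^sub>C (r *\<^sub>R x) = r *\<^sub>R (c *\<^sub>C x)"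
    by (simp flip: scaleC_of_real add: scaleC_scaleC mult.commute)
qed (simp_all add: scaleC_add_right norm_scaleC mult.commute)

lemma bounded_linear_cinner_left: "bounded_linear (\<lambda>x. cinner x y)"
  by (rule bounded_linear_intro[where K = "norm y"])
    (simp_all add: cinner_simps cinner_bound scaleR_conv_of_real)

lemma bounded_linear_cinner_right: "bounded_linear (\<lambda>y. cinner x y)"
  by (rule bounded_linear_intro[where K = "norm x"])
    (simp_all add: cinner_simps cinner_bound scaleR_conv_of_real mult.commute[of _ "norm x"])

lemma scaleC_diff_right: "c *\<^sub>C (x - y) = c *\<^sub>C x - c *\<^sub>C y"
  using linear_diff[OF bounded_linear.linear[OF bounded_linear_scaleC]] .

lemma scaleC_minus_left: "(- c) *\<^sub>C x = - (c *\<^sub>C x)"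
  using scaleC_scaleC[of "- 1" c x] by (simp add: scaleC_minus1)

lemma bounded_clinearD:
  assumes "bounded_clinear T"
  shows "bounded_linear T" "linear T" "T (c *\<^sub>C x) = c *\<^sub>C T x"
  using assms by (auto simp: bounded_clinear_def bounded_linear.linear)

lemma bounded_clinearI:
  assumes "\<And>x y. T (x + y) = T x + T y" "\<And>c x. T (c *\<^sub>C x) = c *\<^sub>C T x"
    and "\<And>x. norm (T x) \<le> C * norm x"
  shows "bounded_clinear T"
  unfolding bounded_clinear_def
  by (intro conjI allI bounded_linear_intro[where K = C])
    (simp_all add: assms mult.commute flip: scaleC_of_real)

text \<open>The midpoints of a minimizing sequence lie in the subspace, so the parallelogram law makes
  the sequence Cauchy.\<close>

lemma projection_exists:
  fixes M :: "'a::real_inner set"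
  assumes M: "subspace M" "complete M"
  shows "\<exists>y\<in>M. \<forall>z\<in>M. inner (x - y) z = 0"
proof -
  define d where "d = Inf ((\<lambda>y. (norm (x - y))\<^sup>2) ` M)"
  have bdd: "bdd_below ((\<lambda>y. (norm (x - y))\<^sup>2) ` M)"
    by (intro bdd_belowI[of _ 0]) auto
  have d: "d \<le> (norm (x - y))\<^sup>2" if "y \<in> M" for y
    unfolding d_def by (intro cInf_lower imageI that bdd)
  have ne: "(\<lambda>y. (norm (x - y))\<^sup>2) ` M \<noteq> {}"
    using subspace_0[OF M(1)] by auto
  have "\<exists>y\<in>M. (norm (x - y))\<^sup>2 < d + 1 / Suc n" for n
    using cInf_less_iff[OF ne bdd, of "d + 1 / Suc n"] by (auto simp: d_def)
  then obtain y where y: "y n \<in> M" "(norm (x - y n))\<^sup>2 < d + 1 / Suc n" for n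
    by metis
  have par: "(norm (y m - y n))\<^sup>2 \<le> 2 / Suc m + 2 / Suc n" for m n
  proof -
    have "(1/2) *\<^sub>R (y m + y n) \<in> M"
      using M(1) y(1) by (intro subspace_scale subspace_add)
    from d[OF this]
    have "4 * d \<le> (norm (2 *\<^sub>R (x - (1/2) *\<^sub>R (y m + y n))))\<^sup>2"
      by (simp add: power_mult_distrib)
    also have "2 *\<^sub>R (x - (1/2) *\<^sub>R (y m + y n)) = (x - y m) + (x - y n)"
      by (simp add: algebra_simps scaleR_2)
    finally have "4 * d \<le> (norm ((x - y m) + (x - y n)))\<^sup>2" .
    moreover have "(norm ((x - y m) + (x - y n)))\<^sup>2 + (norm ((x - y n) - (x - y m)))\<^sup>2
        = 2 * (norm (x - y m))\<^sup>2 + 2 * (norm (x - y n))\<^sup>2"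
      by (simp only: power2_norm_eq_inner)
         (simp add: inner_diff inner_add inner_commute algebra_simps)
    ultimately show ?thesis
      using y(2)[of m] y(2)[of n] by simp
  qed
  have "Cauchy y"
  proof (rule metric_CauchyI)
    fix e :: real assume e: "e > 0"
    obtain N where N: "4 / e\<^sup>2 < real N"
      using reals_Archimedean2 by blast
    have "dist (y m) (y n) < e" if "m \<ge> N" "n \<ge> N" for m n
    proof -
      have lt: "2 / Suc k < e\<^sup>2 / 2" if "k \<ge> N" for k
      proof -
        have "4 / e\<^sup>2 < Suc k"
          using N that by linarith
        then show ?thesis
          using e by (simp add: field_simps)
      qed
      have "(norm (y m - y n))\<^sup>2 < e\<^sup>2"
        using par[of m n] lt[OF that(1)] lt[OF that(2)] by linarith
      then show ?thesis
        using e by (simp add: dist_norm power2_less_imp_less)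
    qed
    then show "\<exists>N. \<forall>m\<ge>N. \<forall>n\<ge>N. dist (y m) (y n) < e"
      by blast
  qed
  then obtain l where l: "l \<in> M" "y \<longlonglongrightarrow> l"
    using M(2) y(1) unfolding complete_def by blast
  have "(norm (x - l))\<^sup>2 \<le> d"
  proof (rule tendsto_le[OF sequentially_bot])
    show "(\<lambda>n. (norm (x - y n))\<^sup>2) \<longlonglongrightarrow> (norm (x - l))\<^sup>2"
      by (intro tendsto_intros l)
    show "(\<lambda>n. d + 1 / Suc n) \<longlonglongrightarrow> d"
      using LIMSEQ_inverse_real_of_nat_add[of d] by (simp add: inverse_eq_divide add.commute)
  qed (intro always_eventually allI less_imp_le y(2))
  have "inner (x - l) z = 0" if z: "z \<in> M" for z
  proof (cases "z = 0")
    case False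
    define a s where "a = inner (x - l) z" and "s = inner z z"
    have s: "s > 0"
      using False by (simp add: s_def)
    \<comment> \<open>Among the points l + t z, the choice t = a / s is closest to x; it would lower
      the squared distance by a^2 / s, which minimality forbids unless a = 0.\<close>
    have "l + (a / s) *\<^sub>R z \<in> M"
      using l z M(1) by (intro subspace_add subspace_scale)
    from d[OF this] \<open>(norm (x - l))\<^sup>2 \<le> d\<close>
    have "(norm (x - l))\<^sup>2 \<le> (norm ((x - l) - (a / s) *\<^sub>R z))\<^sup>2"
      unfolding diff_diff_eq by linarith
    also have "\<dots> = (norm (x - l))\<^sup>2 - 2 * (a / s) * a + (a / s)\<^sup>2 * s"
    proof -
      have "(norm (w - t *\<^sub>R z))\<^sup>2 = (norm w)\<^sup>2 - 2 * t * inner w z + t\<^sup>2 * inner z z" for w t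
        unfolding power2_norm_eq_inner
        by (simp add: inner_diff inner_commute power2_eq_square)
      then show ?thesis
        by (simp add: a_def s_def)
    qed
    also have "\<dots> = (norm (x - l))\<^sup>2 - a\<^sup>2 / s"
      using s by (simp add: field_simps power2_eq_square)
    finally have "a\<^sup>2 \<le> 0"
      using s by (simp add: field_simps)
    then show ?thesis
      by (simp add: a_def)
  qed simp
  with l show ?thesis
    by blast
qed

text \<open>Only the real inner product enters, so that one projection serves both complex subspaces
  (graphs, model spaces) and the merely real subspace on which a conjugation is built.\<close>

definition proj :: "'a::real_inner set \<Rightarrow> 'a \<Rightarrow> 'a" where
  "proj M x = (SOME y. y \<in> M \<and> (\<forall>z\<in>M. inner (x - y) z = 0))"

context
  fixes M :: "'a::real_inner set"
  assumes M: "subspace M" "complete M"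
begin

lemma proj_in: "proj M x \<in> M"
  and proj_orth: "z \<in> M \<Longrightarrow> inner (x - proj M x) z = 0"
proof -
  have "\<exists>y. y \<in> M \<and> (\<forall>z\<in>M. inner (x - y) z = 0)"
    using projection_exists[OF M] by blast
  from someI_ex[OF this]
  show "proj M x \<in> M" "z \<in> M \<Longrightarrow> inner (x - proj M x) z = 0"
    by (auto simp: proj_def)
qed

lemma proj_eqI:
  assumes "y \<in> M" "\<And>z. z \<in> M \<Longrightarrow> inner (x - y) z = 0"
  shows "proj M x = y"
proof -
  have "y - proj M x \<in> M"
    using M(1) assms(1) proj_in by (rule subspace_diff)
  from assms(2)[OF this] proj_orth[OF this, of x]
  have "inner (y - proj M x) (y - proj M x) = 0"
    by (simp add: inner_diff algebra_simps)
  then show ?thesis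
    by simp
qed

lemma proj_add: "proj M (x + y) = proj M x + proj M y"
proof (rule proj_eqI)
  show "inner (x + y - (proj M x + proj M y)) z = 0" if "z \<in> M" for z
    using proj_orth[OF that, of x] proj_orth[OF that, of y] by (simp add: inner_diff inner_add)
qed (intro subspace_add M proj_in)

lemma norm_proj: "norm (proj M x) \<le> norm x"
proof -
  have "(norm (proj M x))\<^sup>2 = inner x (proj M x)"
    using proj_orth[OF proj_in, of x x] by (simp add: inner_diff power2_norm_eq_inner)
  also have "\<dots> \<le> norm x * norm (proj M x)"
    by (rule norm_cauchy_schwarz)
  finally show ?thesis
    by (cases "norm (proj M x) = 0") (auto simp: power2_eq_square)
qed

end

text \<open>A complex subspace contains \<i> z along with z, and the real inner product with \<i> z
  is the imaginary part of the complex one with z.\<close>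

lemma proj_corth:
  fixes M :: "'a::complex_inner set"
  assumes M: "subspace M" "complete M" and c: "\<And>c x. x \<in> M \<Longrightarrow> c *\<^sub>C x \<in> M"
    and z: "z \<in> M"
  shows "cinner (x - proj M x) z = 0"
  using proj_orth[OF M z, of x] proj_orth[OF M c[OF z], of x \<i>]
  by (simp add: complex_eq_iff Re_cinner Im_cinner)

lemma proj_scaleC:
  fixes M :: "'a::complex_inner set"
  assumes M: "subspace M" "complete M" and c: "\<And>c x. x \<in> M \<Longrightarrow> c *\<^sub>C x \<in> M"
  shows "proj M (a *\<^sub>C x) = a *\<^sub>C proj M x"
proof (rule proj_eqI[OF M])
  show "inner (a *\<^sub>C x - a *\<^sub>C proj M x) z = 0" if "z \<in> M" for z
    using proj_corth[OF M c that, of x]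
    by (simp flip: Re_cinner scaleC_diff_right add: cinner_scaleC_left)
qed (intro c proj_in M)

lemma orth_proj_eq_proj:
  fixes M :: "'a::complex_inner set"
  assumes M: "subspace M" "complete M" and c: "\<And>c x. x \<in> M \<Longrightarrow> c *\<^sub>C x \<in> M"
  shows "orth_proj M x = proj M x"
  unfolding orth_proj_def
proof (rule the_equality)
  show "proj M x \<in> M \<and> (\<forall>z\<in>M. cinner (x - proj M x) z = 0)"
    using proj_in[OF M] proj_corth[OF M c] by blast
  show "y = proj M x" if "y \<in> M \<and> (\<forall>z\<in>M. cinner (x - y) z = 0)" for y
    using that by (intro proj_eqI[OF M, symmetric]) (auto simp flip: Re_cinner)
qed

section \<open>Riesz representation and adjoints\<close>

lemma Riesz:
  fixes f :: "'a::complex_hilbert \<Rightarrow> complex"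
  assumes f: "bounded_linear f" "\<And>c x. f (c *\<^sub>C x) = c * f x"
  shows "\<exists>w. \<forall>x. f x = cinner x w"
proof (cases "\<forall>x. f x = 0")
  case True
  then show ?thesis
    by (intro exI[of _ 0]) simp
next
  case False
  then obtain x0 where x0: "f x0 \<noteq> 0"
    by blast
  define M where "M = f -` {0}"
  interpret f: bounded_linear f
    by (rule f)
  have "subspace M"
    by (auto simp: M_def subspace_def f.zero f.add f.scaleR)
  moreover have "closed M"
    unfolding M_def by (intro continuous_closed_vimage f.isCont continuous_ident) simp
  ultimately have M: "subspace M" "complete M"
    by (simp_all add: complete_eq_closed)
  have c: "c *\<^sub>C x \<in> M" if "x \<in> M" for c x
    using that by (simp add: M_def f(2))
  define z where "z = x0 - proj M x0"
  have fz: "f z = f x0"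
    using proj_in[OF M, of x0] by (simp add: z_def f.diff M_def)
  then have z: "z \<noteq> 0"
    using x0 by (auto simp: f.zero)
  have *: "f x * cinner z z = f z * cinner x z" for x
  proof -
    \<comment> \<open>This combination of x and the normal vector z lies in the kernel of f, hence
      is orthogonal to z; that equation expresses f x through the inner product with z.\<close>
    have "f z *\<^sub>C x - f x *\<^sub>C z \<in> M"
      by (simp add: M_def f.diff f(2))
    from proj_corth[OF M c this, of x0]
    have "cinner (f z *\<^sub>C x - f x *\<^sub>C z) z = 0"
      by (metis z_def cinner_commute complex_cnj_zero)
    then show ?thesis
      by (simp add: cinner_simps)
  qed
  have "f x = cinner x ((cnj (f z) / cinner z z) *\<^sub>C z)" for x
    using *[of x] z by (simp add: cinner_simps cinner_self field_simps)
  then show ?thesis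
    by blast
qed

lemma cadjointI:
  assumes "\<And>x y. cinner (T x) y = cinner x (S y)"
  shows "cadjoint T = S"
  unfolding cadjoint_def
proof (rule the_equality)
  fix S' assume "\<forall>x y. cinner (T x) y = cinner x (S' y)"
  then have "S' y = S y" for y
    using assms by (intro cinner_eqI_right) metis
  then show "S' = S"
    by blast
qed (use assms in blast)

text \<open>The adjoint relation alone forces linearity of S, and testing S y against itself
  transfers the bound. With T = S, a bounded symmetric map is linear without further work.\<close>

lemma bounded_clinear_adjoint_pair:
  fixes T :: "'a::complex_inner \<Rightarrow> 'b::complex_inner"
  assumes adj: "\<And>x y. cinner (T x) y = cinner x (S y)" and le: "\<And>x. norm (T x) \<le> C * norm x"
    and C: "C \<ge> 0"
  shows "bounded_clinear S" "norm (S y) \<le> C * norm y"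
proof -
  have S: "norm (S y) \<le> C * norm y" for y
  proof -
    have "(norm (S y))\<^sup>2 = cmod (cinner (S y) (S y))"
      by (simp add: cinner_self del: of_real_power)
    also have "\<dots> = cmod (cinner (T (S y)) y)"
      by (simp add: adj)
    also have "\<dots> \<le> C * norm (S y) * norm y"
      by (rule order_trans[OF cinner_bound mult_right_mono[OF le norm_ge_zero]])
    finally show ?thesis
      using C by (cases "norm (S y) = 0") (auto simp: power2_eq_square)
  qed
  then show "norm (S y) \<le> C * norm y" .
  show "bounded_clinear S"
    by (rule bounded_clinearI[OF _ _ S])
      (rule cinner_eqI_right; simp add: cinner_simps flip: adj)+
qed

lemma cadjoint:
  fixes T :: "'a::complex_hilbert \<Rightarrow> 'b::complex_inner"
  assumes "bounded_clinear T"
  shows "cinner (T x) y = cinner x (cadjoint T y)"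
proof -
  have "\<exists>w. \<forall>x. cinner (T x) y = cinner x w" for y
    using assms
    by (intro Riesz bounded_linear_compose[OF bounded_linear_cinner_left])
      (auto simp: bounded_clinear_def cinner_simps)
  then obtain S where "\<And>y x. cinner (T x) y = cinner x (S y)"
    by metis
  then show ?thesis
    using cadjointI by metis
qed

section \<open>Complex symmetry\<close>

text \<open>The iteration \<open>y \<mapsto> (x + y\<^sup>2) / 2\<close>, whose limit \<open>l\<close> satisfies \<open>(1 - l)\<^sup>2 = 1 - x\<close>, converges
  in norm also when \<open>\<parallel>x\<parallel> = 1\<close>: its increments are dominated by those of the same scalar iteration
  started at \<open>x = 1\<close>.\<close>

lemma sqrt_iteration:
  fixes X :: "'a::banach \<Rightarrow>\<^sub>L 'a"
  assumes X: "norm X \<le> 1"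
  obtains Y L where "Y 0 = 0" "\<And>n. Y (Suc n) = (1/2) *\<^sub>R (X + (Y n o\<^sub>L Y n))" "Y \<longlonglongrightarrow> L"
proof -
  define Y where "Y = rec_nat (0 :: 'a \<Rightarrow>\<^sub>L 'a) (\<lambda>_ y. (1/2) *\<^sub>R (X + (y o\<^sub>L y)))"
  define t where "t = rec_nat (0 :: real) (\<lambda>_ s. (1 + s\<^sup>2) / 2)"
  have Y: "Y 0 = 0" "\<And>n. Y (Suc n) = (1/2) *\<^sub>R (X + (Y n o\<^sub>L Y n))"
    and t: "t 0 = 0" "\<And>n. t (Suc n) = (1 + (t n)\<^sup>2) / 2"
    by (simp_all add: Y_def t_def)
  have t01: "0 \<le> t n \<and> t n \<le> 1" for n
    by (induction n) (auto simp: t power_le_one)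
  \<comment> \<open>The increment is (1 - t n)^2 / 2.\<close>
  have tinc: "t n \<le> t (Suc n)" for n
    using zero_le_power2[of "1 - t n"] by (simp add: t power2_diff)
  have nY: "norm (Y n) \<le> t n" for n
  proof (induction n)
    case (Suc n)
    have "norm (Y n o\<^sub>L Y n) \<le> (t n)\<^sup>2"
      unfolding power2_eq_square
      by (intro order_trans[OF norm_blinfun_compose] mult_mono Suc) (use t01 in auto)
    then show ?case
      using X norm_triangle_ineq[of X "Y n o\<^sub>L Y n"] by (simp add: Y t)
  qed (simp add: Y t)
  interpret comp: bounded_bilinear "(o\<^sub>L) :: ('a \<Rightarrow>\<^sub>L 'a) \<Rightarrow> ('a \<Rightarrow>\<^sub>L 'a) \<Rightarrow> ('a \<Rightarrow>\<^sub>L 'a)"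
    by (rule bounded_bilinear_blinfun_compose)
  have dY: "norm (Y (Suc n) - Y n) \<le> t (Suc n) - t n" for n
  proof (induction n)
    case 0
    then show ?case
      using X by (simp add: Y t)
  next
    case (Suc n)
    define D where "D = Y (Suc n) - Y n"
    define d where "d = t (Suc n) - t n"
    have "Y (Suc (Suc n)) - Y (Suc n)
        = (1/2) *\<^sub>R ((Y (Suc n) o\<^sub>L Y (Suc n)) - (Y n o\<^sub>L Y n))"
      unfolding Y(2)[of "Suc n"] by (subst (3) Y(2)) (simp flip: scaleR_diff_right)
    \<comment> \<open>The order of the factors is kept, since the iterates are not known to commute;
      the scalar increments factor in the same pattern.\<close>
    also have "(Y (Suc n) o\<^sub>L Y (Suc n)) - (Y n o\<^sub>L Y n) = (Y (Suc n) o\<^sub>L D) + (D o\<^sub>L Y n)"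
      by (simp add: D_def comp.diff_left comp.diff_right)
    also have "norm ((1/2) *\<^sub>R \<dots>) \<le> (norm (Y (Suc n) o\<^sub>L D) + norm (D o\<^sub>L Y n)) / 2"
      using norm_triangle_ineq[of "Y (Suc n) o\<^sub>L D" "D o\<^sub>L Y n"] by simp
    also have "norm (Y (Suc n) o\<^sub>L D) \<le> t (Suc n) * d"
      using Suc by (intro order_trans[OF norm_blinfun_compose] mult_mono nY)
        (use t01 in \<open>auto simp: D_def d_def\<close>)
    also have "norm (D o\<^sub>L Y n) \<le> d * t n"
      using Suc tinc[of n] by (intro order_trans[OF norm_blinfun_compose] mult_mono nY)
        (use t01 in \<open>auto simp: D_def d_def\<close>)
    also have "(t (Suc n) * d + d * t n) / 2 = t (Suc (Suc n)) - t (Suc n)"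
    proof -
      have "(a * (a - b) + (a - b) * b) / 2 = (1 + a\<^sup>2) / 2 - (1 + b\<^sup>2) / 2" for a b :: real
        by (simp add: power2_eq_square field_simps)
      from this[of "t (Suc n)" "t n"] show ?thesis
        by (simp only: t(2)[symmetric] d_def)
    qed
    finally show ?case
      by simp
  qed
  \<comment> \<open>The scalar sequence is monotone and bounded, so its telescoping increments form
    a convergent majorant.\<close>
  have "convergent t"
    using t01 tinc by (intro Bseq_monoseq_convergent BseqI'[of _ 1])
      (auto simp: monoseq_Suc)
  then have "summable (\<lambda>n. t (Suc n) - t n)"
    unfolding convergent_def by (metis telescope_summable)
  then have "summable (\<lambda>n. Y (Suc n) - Y n)"
    by (rule summable_comparison_test') (rule dY)
  then have "convergent (\<lambda>n. \<Sum>i<n. Y (Suc i) - Y i)"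
    by (simp add: summable_iff_convergent)
  then have "convergent Y"
    by (simp add: sum_lessThan_telescope Y(1))
  then show thesis
    using that Y unfolding convergent_def by blast
qed

text \<open>For X = 1 - A* A / c^2 the limit L of \<open>sqrt_iteration\<close> satisfies (1 - L)^2
  = A* A / c^2, so c (1 - L) is a square root of A* A. Dividing by c^2, with c a bound for A, makes
  X a contraction.\<close>

lemma selfadjoint_root:
  fixes A :: "'a::complex_hilbert \<Rightarrow> 'b::complex_hilbert"
  assumes A: "bounded_clinear A"
  obtains S :: "'a \<Rightarrow> 'a" where "bounded_clinear S" "\<And>x y. cinner (S x) y = cinner x (S y)"
    "\<And>x. S (S x) = cadjoint A (A x)"
proof -
  obtain c where c: "c > 0" "\<And>x. norm (A x) \<le> c * norm x"
    using bounded_linear.pos_bounded[OF bounded_clinearD(1)[OF A]] by (metis mult.commute)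
  let ?A' = "cadjoint A"
  have A': "bounded_clinear ?A'" "norm (?A' y) \<le> c * norm y" for y
    using bounded_clinear_adjoint_pair[of A ?A' c, OF cadjoint[OF A] c(2)] c(1) by auto
  define B where "B x = (1 / c\<^sup>2) *\<^sub>R ?A' (A x)" for x
  have Bin: "cinner (B x) y = (1 / c\<^sup>2) * cinner (A x) (A y)" for x y
    unfolding B_def using cadjoint[OF A, of y "A x"]
    by (simp add: cinner_simps) (metis cinner_commute)
  have Bsym: "cinner (B x) y = cinner x (B y)" for x y
    using Bin[of x y] Bin[of y x] cinner_commute[of "A x" "A y"] cinner_commute[of x "B y"] by simp
  have le: "norm (x - B x) \<le> 1 * norm x" for x
  proof -
    \<comment> \<open>Once |B x|^2 is at most <B x, x>, the expansion |x|^2 - 2 <B x, x> + |B x|^2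
      of |x - B x|^2 is at most |x|^2.\<close>
    have "(norm (B x))\<^sup>2 \<le> ((1 / c\<^sup>2) * (c * norm (A x)))\<^sup>2"
      by (rule power_mono) (use c A'(2)[of "A x"] in \<open>auto simp: B_def divide_right_mono\<close>)
    also have "\<dots> = (norm (A x))\<^sup>2 / c\<^sup>2"
      using c by (simp add: power2_eq_square field_simps)
    also have "\<dots> = inner (B x) x"
      unfolding Re_cinner[symmetric] Bin by (simp add: cinner_self flip: of_real_power)
    finally have "(norm (x - B x))\<^sup>2 \<le> (norm x)\<^sup>2 - inner (B x) x"
      by (simp add: power2_norm_eq_inner inner_diff inner_commute)
    moreover have "0 \<le> inner (B x) x"
      unfolding Re_cinner[symmetric] Bin by (simp add: cinner_self flip: of_real_power)
    ultimately have "(norm (x - B x))\<^sup>2 \<le> (norm x)\<^sup>2"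
      by linarith
    then show ?thesis
      using power2_le_imp_le[of "norm (x - B x)" "norm x"] by simp
  qed
  have Bl: "bounded_clinear (\<lambda>x. x - B x)"
    by (rule bounded_clinearI[OF _ _ le]; rule cinner_eqI) (simp_all add: cinner_simps Bsym algebra_simps)
  define X where "X = Blinfun (\<lambda>x. x - B x)"
  have X: "blinfun_apply X x = x - B x" for x
    unfolding X_def by (simp add: bounded_linear_Blinfun_apply bounded_clinearD(1)[OF Bl])
  have "norm X \<le> 1"
    using le by (intro norm_blinfun_bound) (auto simp: X)
  then obtain Y L where Y: "Y 0 = 0" "\<And>n. Y (Suc n) = (1/2) *\<^sub>R (X + (Y n o\<^sub>L Y n))"
      and lim: "Y \<longlonglongrightarrow> L"
    using sqrt_iteration by blast
  have YS: "blinfun_apply (Y (Suc n)) x = (1/2) *\<^sub>R (x - B x + Y n (Y n x))" for n x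
    by (simp add: Y X blinfun.bilinear_simps)
  have Ysym: "cinner (Y n x) y = cinner x (Y n y)" for n x y
    by (induction n arbitrary: x y) (simp_all add: Y(1) YS cinner_simps Bsym)
  have lx: "(\<lambda>n. Y n x) \<longlonglongrightarrow> L x" for x
    by (intro tendsto_intros lim)
  have Lsym: "cinner (L x) y = cinner x (L y)" for x y
  proof (rule LIMSEQ_unique)
    show "(\<lambda>n. cinner (Y n x) y) \<longlonglongrightarrow> cinner (L x) y"
      by (rule bounded_linear.tendsto[OF bounded_linear_cinner_left lx])
    show "(\<lambda>n. cinner (Y n x) y) \<longlonglongrightarrow> cinner x (L y)"
      unfolding Ysym by (rule bounded_linear.tendsto[OF bounded_linear_cinner_right lx])
  qed
  have "(\<lambda>n. (1/2) *\<^sub>R (X + (Y n o\<^sub>L Y n))) \<longlonglongrightarrow> (1/2) *\<^sub>R (X + (L o\<^sub>L L))"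
    by (intro tendsto_intros bounded_bilinear.tendsto[OF bounded_bilinear_blinfun_compose] lim)
  moreover have "(\<lambda>n. (1/2) *\<^sub>R (X + (Y n o\<^sub>L Y n))) \<longlonglongrightarrow> L"
    using LIMSEQ_Suc[OF lim] by (simp add: Y)
  ultimately have "L = (1/2) *\<^sub>R (X + (L o\<^sub>L L))"
    using LIMSEQ_unique by blast
  from arg_cong[OF this, of "\<lambda>f. 2 *\<^sub>R blinfun_apply f x" for x]
  have L: "2 *\<^sub>R blinfun_apply L x = x - B x + L (L x)" for x
    by (simp add: X blinfun.bilinear_simps)
  define S where "S x = c *\<^sub>R (x - L x)" for x
  have sym: "cinner (S x) y = cinner x (S y)" for x y
    by (simp add: S_def cinner_simps Lsym)
  have "norm (S x) \<le> (c * (1 + norm L)) * norm x" for x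
  proof -
    have "norm (x - L x) \<le> (1 + norm L) * norm x"
      using norm_triangle_ineq4[of x "L x"] norm_blinfun[of L x] by (simp add: algebra_simps)
    then show ?thesis
      using c by (simp add: S_def)
  qed
  then have "bounded_clinear S"
    by (rule bounded_clinear_adjoint_pair(1)[OF sym]) (use c in simp)
  moreover have "S (S x) = cadjoint A (A x)" for x
  proof -
    have "S (S x) = c\<^sup>2 *\<^sub>R (x - 2 *\<^sub>R blinfun_apply L x + L (L x))"
      by (simp add: S_def blinfun.bilinear_simps scaleR_2 power2_eq_square algebra_simps)
    also have "\<dots> = c\<^sup>2 *\<^sub>R B x"
      unfolding L by simp
    finally show ?thesis
      using c by (simp add: B_def)
  qed
  ultimately show thesis
    using that sym by blast
qed

text \<open>\<open>K\<close> is the reflection in a maximal \<open>S\<close>-invariant set on which the inner product is real: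
  such a set \<open>R\<close> is a closed real subspace, and by maximality \<open>H = R + iR\<close>.\<close>

lemma conjugation_commuting:
  fixes S :: "'a::complex_hilbert \<Rightarrow> 'a"
  assumes S: "bounded_clinear S" and sym: "\<And>x y. cinner (S x) y = cinner x (S y)"
  obtains K where "conjugation K" "\<And>x. K (S x) = S (K x)"
proof -
  define \<A> where "\<A> = {R. (\<forall>x\<in>R. S x \<in> R) \<and> (\<forall>x\<in>R. \<forall>y\<in>R. Im (cinner x y) = 0)}"
  have "\<Union>C \<in> \<A>" if C: "subset.chain \<A> C" for C
  proof -
    have "Im (cinner x y) = 0" if "x \<in> \<Union>C" "y \<in> \<Union>C" for x y
    proof -
      obtain P Q where "P \<in> C" "Q \<in> C" "x \<in> P" "y \<in> Q"
        using \<open>x \<in> \<Union>C\<close> \<open>y \<in> \<Union>C\<close> by blast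
      moreover have "P \<subseteq> Q \<or> Q \<subseteq> P"
        using C \<open>P \<in> C\<close> \<open>Q \<in> C\<close> by (auto simp: subset.chain_def subset_chain_def)
      moreover have "P \<in> \<A>" "Q \<in> \<A>"
        using C \<open>P \<in> C\<close> \<open>Q \<in> C\<close> by (auto simp: subset_chain_def)
      ultimately show ?thesis
        unfolding \<A>_def by blast
    qed
    moreover have "S x \<in> \<Union>C" if "x \<in> \<Union>C" for x
      using that C by (auto simp: subset_chain_def \<A>_def)
    ultimately show ?thesis
      by (simp add: \<A>_def)
  qed
  then obtain R where R: "R \<in> \<A>" and max: "\<And>Q. Q \<in> \<A> \<Longrightarrow> R \<subseteq> Q \<Longrightarrow> Q = R"
    using subset_Zorn'[of \<A>] by blast
  have RS: "S x \<in> R" if "x \<in> R" for x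
    using R that by (auto simp: \<A>_def)
  have Rre: "Im (cinner x y) = 0" if "x \<in> R" "y \<in> R" for x y
    using R that by (auto simp: \<A>_def)
  have linS: "linear S" and bS: "bounded_linear S"
    using bounded_clinearD[OF S] by auto
  have spanre: "Im (cinner x y) = 0" if x: "x \<in> span R" and y: "y \<in> span R" for x y
  proof -
    have "Im (cinner x y) = 0" if "y \<in> R" for y
      using x by (rule span_induct) (auto simp: subspace_def cinner_simps Rre that)
    then show ?thesis
      using y by (rule_tac span_induct[of y]) (auto simp: subspace_def cinner_simps)
  qed
  have "S x \<in> span R" if "x \<in> span R" for x
    using that
    by (rule span_induct) (auto simp: subspace_def linear_add[OF linS] linear_scale[OF linS]
        linear_0[OF linS] span_zero span_add span_scale span_base RS)
  then have "span R \<in> \<A>"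
    using spanre by (simp add: \<A>_def)
  from max[OF this span_superset] have sub: "subspace R"
    by (metis subspace_span)
  have clre: "Im (cinner x y) = 0" if x: "x \<in> closure R" and y: "y \<in> closure R" for x y
  proof -
    have cont: "continuous_on UNIV (\<lambda>x. Im (cinner x y))" "continuous_on UNIV (\<lambda>y. Im (cinner x y))"
      for x y :: 'a
      by (intro continuous_on_Im linear_continuous_on bounded_linear_cinner_left
          bounded_linear_cinner_right)+
    have cl: "closed {x. Im (cinner x y) = 0}" "closed {y. Im (cinner x y) = 0}" for x y :: 'a
      using cont by (auto intro!: closed_Collect_eq)
    have "closure R \<subseteq> {x. Im (cinner x y) = 0}" if "y \<in> R" for y
      by (rule closure_minimal[OF _ cl(1)]) (auto simp: Rre that)
    then have "closure R \<subseteq> {y. Im (cinner x y) = 0}"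
      using x by (intro closure_minimal[OF _ cl(2)]) auto
    then show ?thesis
      using y by auto
  qed
  have "closure R \<subseteq> S -` closure R"
  proof (rule closure_minimal)
    show "closed (S -` closure R)"
      by (intro continuous_closed_vimage closed_closure linear_continuous_at bS)
  qed (use RS closure_subset in blast)
  then have "closure R \<in> \<A>"
    using clre by (auto simp: \<A>_def)
  from max[OF this closure_subset] have "complete R"
    by (metis closed_closure complete_eq_closed)
  note M = sub this
  define P where "P = proj R"
  have P: "P x \<in> R" "r \<in> R \<Longrightarrow> inner (x - P x) r = 0" for x r
    unfolding P_def using proj_in[OF M] proj_orth[OF M] by auto
  \<comment> \<open>If x is orthogonal to R, its whole S-orbit can be added to R: the orbit is
    orthogonal to R, and <S^n x, S^m x> = <x, S^(n+m) x> is real by symmetry. Maximality puts x into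
    R, so x is orthogonal to itself.\<close>
  have cyclic: "x = 0" if x: "\<And>r. r \<in> R \<Longrightarrow> cinner x r = 0" for x
  proof -
    define Q where "Q = R \<union> range (\<lambda>n. (S ^^ n) x)"
    have symn: "cinner ((S ^^ n) x) y = cinner x ((S ^^ n) y)" for n x y
      by (induction n arbitrary: x y) (simp_all add: sym funpow_swap1)
    have inR: "(S ^^ n) r \<in> R" if "r \<in> R" for n r
      by (induction n) (auto simp: RS that)
    have zero: "cinner ((S ^^ n) x) r = 0" if "r \<in> R" for n r
      unfolding symn using x[OF inR[OF that]] .
    have zero': "cinner r ((S ^^ n) x) = 0" if "r \<in> R" for n r
      by (subst cinner_commute) (simp add: zero that)
    have re: "Im (cinner ((S ^^ n) x) ((S ^^ m) x)) = 0" for m n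
    proof -
      have "cinner ((S ^^ n) x) ((S ^^ m) x) = cinner ((S ^^ m) x) ((S ^^ n) x)"
        unfolding symn by (simp add: add.commute flip: funpow_add[THEN fun_cong, unfolded comp_def])
      then show ?thesis
        using cinner_commute[of "(S ^^ n) x" "(S ^^ m) x"] by (simp add: complex_eq_iff)
    qed
    have "S ((S ^^ n) x) \<in> range (\<lambda>n. (S ^^ n) x)" for n
      by (rule range_eqI[of _ _ "Suc n"]) simp
    then have "Q \<in> \<A>"
      by (auto simp: \<A>_def Q_def RS Rre re zero zero')
    from max[OF this] have "Q = R"
      by (auto simp: Q_def)
    moreover have "x \<in> Q"
      unfolding Q_def by (auto intro: range_eqI[of _ _ 0])
    ultimately have "cinner x x = 0"
      using x by blast
    then show ?thesis
      by (simp add: cinner_self)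
  qed
  have dec: "\<exists>p\<in>R. \<exists>q\<in>R. y = p + \<i> *\<^sub>C q" for y
  proof -
    \<comment> \<open>For r in R, the real part of <- \<i> y, r> is the imaginary part of <y, r>;
      thus p and q reproduce the real and imaginary parts of the inner products of y with R.\<close>
    define p q where "p = P y" and "q = P (- (\<i> *\<^sub>C y))"
    have pq: "p \<in> R" "q \<in> R"
      by (auto simp: p_def q_def P)
    have "y - p - \<i> *\<^sub>C q = 0"
    proof (rule cyclic)
      fix r assume r: "r \<in> R"
      show "cinner (y - p - \<i> *\<^sub>C q) r = 0"
        using P(2)[OF r, of y] P(2)[OF r, of "- (\<i> *\<^sub>C y)"] Rre[OF pq(1) r] Rre[OF pq(2) r]
        unfolding p_def[symmetric] q_def[symmetric]
        by (simp add: complex_eq_iff cinner_simps flip: Re_cinner)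
    qed
    then show ?thesis
      using pq by (intro bexI[of _ p] bexI[of _ q]) (auto simp: algebra_simps)
  qed
  \<comment> \<open>P annihilates \<i> R because inner products within R are real, so this
    reflection sends p + \<i> q to p - \<i> q.\<close>
  define K where "K x = 2 *\<^sub>R P x - x" for x
  have Kpq: "K (p + \<i> *\<^sub>C q) = p - \<i> *\<^sub>C q" if "p \<in> R" "q \<in> R" for p q
  proof -
    have "P (p + \<i> *\<^sub>C q) = p"
      unfolding P_def
      by (rule proj_eqI[OF M]) (use that Rre in \<open>auto simp: cinner_simps simp flip: Re_cinner\<close>)
    then show ?thesis
      by (simp add: K_def scaleR_2)
  qed
  have addK: "K (x + y) = K x + K y" for x y
    by (simp add: K_def P_def proj_add[OF M] algebra_simps)
  have KR: "K (r *\<^sub>R x) = r *\<^sub>R K x" for r x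
  proof -
    have "P (r *\<^sub>R x) = r *\<^sub>R P x"
      unfolding P_def
      by (rule proj_eqI[OF M]) (auto simp: subspace_scale[OF sub] proj_in[OF M] proj_orth[OF M]
          simp flip: scaleR_diff_right)
    then show ?thesis
      by (simp add: K_def algebra_simps)
  qed
  have Ki: "K (\<i> *\<^sub>C x) = - (\<i> *\<^sub>C K x)" for x
  proof -
    obtain p q where pq: "p \<in> R" "q \<in> R" "x = p + \<i> *\<^sub>C q"
      using dec by blast
    have "\<i> *\<^sub>C x = - q + \<i> *\<^sub>C p"
      by (simp add: pq scaleC_add_right scaleC_scaleC scaleC_minus1)
    then have "K (\<i> *\<^sub>C x) = - q - \<i> *\<^sub>C p"
      using Kpq[of "- q" p] pq subspace_neg[OF sub] by simp
    then show ?thesis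
      by (simp add: pq Kpq scaleC_diff_right scaleC_scaleC scaleC_minus1)
  qed
  have "K (c *\<^sub>C x) = cnj c *\<^sub>C K x" for c x
  proof -
    have split: "c *\<^sub>C x = Re c *\<^sub>R x + Im c *\<^sub>R (\<i> *\<^sub>C x)" for c and x :: 'a
      using arg_cong[OF complex_eq[of c], of "\<lambda>c. c *\<^sub>C x"]
      by (simp flip: scaleC_of_real scaleC_add_left add: scaleC_scaleC mult.commute)
    show ?thesis
      by (subst (1 2) split) (simp add: addK KR Ki)
  qed
  moreover have "norm (K x) = norm x" for x
  proof -
    have "(norm (K x))\<^sup>2 = (norm x)\<^sup>2"
      using P(2)[OF P(1)[of x], of x]
      by (simp add: K_def power2_norm_eq_inner inner_diff inner_commute algebra_simps)
    then show ?thesis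
      by simp
  qed
  moreover have "K (K x) = x \<and> K (S x) = S (K x)" for x
  proof -
    obtain p q where pq: "p \<in> R" "q \<in> R" "x = p + \<i> *\<^sub>C q"
      using dec by blast
    have neg: "\<i> *\<^sub>C (- q) = - (\<i> *\<^sub>C q)"
      by (rule linear_neg[OF bounded_linear.linear[OF bounded_linear_scaleC]])
    have "K x = p + \<i> *\<^sub>C (- q)"
      using pq Kpq[of p q] by (simp add: neg)
    then have "K (K x) = p - \<i> *\<^sub>C (- q)"
      using pq Kpq[of p "- q"] subspace_neg[OF sub] by simp
    then have "K (K x) = x"
      by (simp add: neg pq)
    moreover have "S x = S p + \<i> *\<^sub>C S q"
      using pq by (simp add: linear_add[OF linS] bounded_clinearD(3)[OF S])
    then have "K (S x) = S (K x)"
      using pq Kpq[of p q] Kpq[of "S p" "S q"] RS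
      by (simp add: linear_diff[OF linS] bounded_clinearD(3)[OF S])
    ultimately show ?thesis ..
  qed
  ultimately show thesis
    using addK by (intro that[of K]) (auto simp: conjugation_def)
qed

text \<open>By polarization J preserves the real inner product, and antilinearity then flips the
  imaginary part. The resulting symmetry is the rule for moving a conjugation across an inner
  product, in the role an adjoint plays for linear maps.\<close>

lemma conjugation_cinner:
  assumes "conjugation J"
  shows "cinner (J x) y = cinner (J y) x"
proof -
  have J: "J (x + y) = J x + J y" "J (c *\<^sub>C x) = cnj c *\<^sub>C J x" "norm (J x) = norm x" "J (J x) = x"
    for x y c
    using assms by (auto simp: conjugation_def)
  have inner: "inner (J x) (J y) = inner x y" for x y
    by (simp add: dot_norm J flip: J(1))
  have "cinner (J x) (J y) = cinner y x" for x y
  proof -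
    have "inner (J x) (\<i> *\<^sub>C J y) = - inner (J x) (J (\<i> *\<^sub>C y))"
      by (simp add: J scaleC_minus_left)
    also have "\<dots> = - inner x (\<i> *\<^sub>C y)"
      by (simp only: inner)
    also have "\<dots> = Im (cinner y x)"
      using cinner_commute[of x y] by (simp flip: Im_cinner)
    finally show ?thesis
      using inner[of x y] by (simp add: complex_eq_iff Re_cinner Im_cinner inner_commute)
  qed
  from this[of x "J y"] show ?thesis
    by (simp add: J)
qed

lemma subspace_closure:
  fixes M :: "'a::real_normed_vector set"
  assumes "subspace M"
  shows "subspace (closure M)"
  unfolding subspace_def
proof (intro conjI ballI allI)
  show "0 \<in> closure M"
    using subspace_0[OF assms] closure_subset by blast
next
  fix x y assume "x \<in> closure M" "y \<in> closure M"
  then obtain f g where "\<And>n. f n \<in> M" "f \<longlonglongrightarrow> x" "\<And>n. g n \<in> M" "g \<longlonglongrightarrow> y"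
    unfolding closure_sequential by blast
  then have "(\<lambda>n. f n + g n) \<longlonglongrightarrow> x + y" "\<And>n. f n + g n \<in> M"
    using assms by (auto intro: tendsto_add subspace_add)
  then show "x + y \<in> closure M"
    unfolding closure_sequential by (intro exI[of _ "\<lambda>n. f n + g n"]) blast
next
  fix c x assume "x \<in> closure M"
  then obtain f where "\<And>n. f n \<in> M" "f \<longlonglongrightarrow> x"
    unfolding closure_sequential by blast
  then have "(\<lambda>n. c *\<^sub>R f n) \<longlonglongrightarrow> c *\<^sub>R x" "\<And>n. c *\<^sub>R f n \<in> M"
    using assms by (auto intro: tendsto_scaleR subspace_scale)
  then show "c *\<^sub>R x \<in> closure M"
    unfolding closure_sequential by (intro exI[of _ "\<lambda>n. c *\<^sub>R f n"]) blast
qed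

text \<open>The graph of the partial isometry is the closure \<open>G\<close> of all pairs \<open>(S x, A x)\<close>; the orthogonal
  projection onto \<open>G\<close> maps \<open>(S x, 0)\<close> to \<open>(S x, A x) / 2\<close>.\<close>

lemma partial_isometry:
  fixes S :: "'a::complex_inner \<Rightarrow> 'b::complex_hilbert" and A :: "'a \<Rightarrow> 'c::complex_hilbert"
  assumes S: "bounded_clinear S" and A: "bounded_clinear A" and eq: "\<And>x. norm (S x) = norm (A x)"
  obtains V W where "bounded_clinear V" "\<And>x y. cinner (V x) y = cinner x (W y)"
    "\<And>x. V (S x) = A x" "\<And>x. W (A x) = S x"
    "\<And>p. (\<And>x. cinner p (S x) = 0) \<Longrightarrow> V p = 0"
proof -
  define g where "g x = (S x, A x)" for x
  have linS: "linear S" and linA: "linear A"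
    using S A by (auto dest: bounded_clinearD)
  have g: "linear g" "g (c *\<^sub>C x) = c *\<^sub>C g x" for c x
    unfolding g_def using S A linS linA
    by (auto intro!: linearI simp: linear_add linear_scale bounded_clinearD(3) scaleC_prod_def)
  define G where "G = closure (range g)"
  have "subspace G"
    unfolding G_def by (intro subspace_closure linear_subspace_image g subspace_UNIV)
  then have M: "subspace G" "complete G"
    by (simp_all add: G_def complete_eq_closed)
  have c: "c *\<^sub>C z \<in> G" if "z \<in> G" for c z
  proof -
    have "G \<subseteq> (\<lambda>z. c *\<^sub>C z) -` G"
      unfolding G_def
    proof (rule closure_minimal)
      show "closed ((\<lambda>z. c *\<^sub>C z) -` closure (range g))"
        by (intro continuous_closed_vimage closed_closure linear_continuous_at bounded_linear_scaleC)
      show "range g \<subseteq> (\<lambda>z. c *\<^sub>C z) -` closure (range g)"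
      proof
        fix z assume "z \<in> range g"
        then obtain x where "c *\<^sub>C z = g (c *\<^sub>C x)"
          by (auto simp only: g(2))
        then show "z \<in> (\<lambda>z. c *\<^sub>C z) -` closure (range g)"
          using closure_subset[of "range g"] by (metis rangeI subsetD vimageI2)
      qed
    qed
    then show ?thesis
      using that by blast
  qed
  have gG: "g x \<in> G" for x
    unfolding G_def using closure_subset[of "range g"] by blast
  have projI: "proj G z = y" if "y \<in> G" "\<And>x. inner (z - y) (g x) = 0" for z y
  proof (rule proj_eqI[OF M that(1)])
    fix w assume "w \<in> G"
    moreover have "G \<subseteq> {w. inner (z - y) w = 0}"
      unfolding G_def by (rule closure_minimal) (auto simp: that closed_hyperplane)
    ultimately show "inner (z - y) w = 0"
      by blast
  qed
  \<comment> \<open>V and W are the off-diagonal corners of twice the projection onto G; since the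
    projection is self-adjoint, they are adjoint to each other.\<close>
  define V where "V p = 2 *\<^sub>R snd (proj G (p, 0))" for p
  define W where "W q = 2 *\<^sub>R fst (proj G (0, q))" for q
  have psym: "cinner (proj G z) w = cinner z (proj G w)" for z w
  proof -
    have "cinner (z - proj G z) (proj G w) = 0" "cinner (w - proj G w) (proj G z) = 0"
      using proj_corth[OF M c] proj_in[OF M] by auto
    moreover have "cinner (proj G z) (w - proj G w) = cnj (cinner (w - proj G w) (proj G z))"
      by (rule cinner_commute)
    ultimately show ?thesis
      by (simp add: cinner_simps)
  qed
  have adj: "cinner (V p) q = cinner p (W q)" for p q
    using psym[of "(p, 0)" "(0, q)"] by (simp add: V_def W_def cinner_simps cinner_prod_def)
  have "norm (V p) \<le> 2 * norm p" for p
    using norm_snd_le[of "snd (proj G (p, 0))" "fst (proj G (p, 0))"] norm_proj[OF M, of "(p, 0)"]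
    by (simp add: V_def)
  then have bV: "bounded_clinear V"
  proof (rule bounded_clinearI[rotated 2])
    show "V (x + y) = V x + V y" for x y
      using proj_add[OF M, of "(x, 0)" "(y, 0)"] by (simp add: V_def scaleR_add_right)
    show "V (a *\<^sub>C x) = a *\<^sub>C V x" for a x
    proof -
      have "a *\<^sub>C (x, 0) = (a *\<^sub>C x, 0 :: 'c)"
        using linear_0[OF bounded_linear.linear[OF bounded_linear_scaleC]]
        by (simp add: scaleC_prod_def)
      then have "proj G (a *\<^sub>C x, 0) = a *\<^sub>C proj G (x, 0)"
        using proj_scaleC[OF M c, of a "(x, 0)"] by simp
      then show ?thesis
        by (simp add: V_def scaleC_prod_def
            linear_scale[OF bounded_linear.linear[OF bounded_linear_scaleC]])
    qed
  qed
  have in_eq: "inner (S x) (S y) = inner (A x) (A y)" for x y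
    by (simp add: dot_norm eq flip: linear_add[OF linS] linear_add[OF linA])
  have half: "(1/2) *\<^sub>R g x \<in> G" for x
    by (intro subspace_scale M gG)
  \<comment> \<open>The remainder of (S x, 0) is (S x, - A x) / 2, orthogonal to every (S y, A y)
    because S and A induce the same inner products. The factor 2 in V and W undoes this
    half.\<close>
  have "proj G (S x, 0) = (1/2) *\<^sub>R g x" "proj G (0, A x) = (1/2) *\<^sub>R g x" for x
    by (rule projI[OF half]; simp add: g_def inner_diff in_eq)+
  then have "V (S x) = A x" "W (A x) = S x" for x
    by (simp_all add: V_def W_def g_def)
  moreover have "V p = 0" if "\<And>x. cinner p (S x) = 0" for p
  proof -
    have "proj G (p, 0) = 0"
      by (rule projI) (simp_all add: subspace_0[OF M(1)] g_def that cinner_prod_def flip: Re_cinner)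
    then show ?thesis
      by (simp add: V_def)
  qed
  ultimately show thesis
    using that bV adj by blast
qed

text \<open>With the polar decomposition \<open>A = V S\<close> (\<open>S\<close> self-adjoint, \<open>V\<close> a partial isometry with adjoint
  \<open>W\<close>) and a conjugation \<open>K\<close> commuting with \<open>S\<close>, the antiunitary \<open>V K\<close> exchanges the initial and the
  final space of \<open>V\<close>; on the complements, where the operator and its adjoint vanish, any conjugation
  will do.\<close>

lemma complex_symmetric_off_diagonal:
  fixes A :: "'a::complex_hilbert \<Rightarrow> 'a"
  assumes A: "bounded_clinear A"
  shows "complex_symmetric (\<lambda>(x, y). (A y, 0 :: 'a))"
proof -
  let ?T = "\<lambda>(x :: 'a, y). (A y, 0 :: 'a)"
  obtain S where S: "bounded_clinear S" and Ssym: "\<And>x y. cinner (S x) y = cinner x (S y)"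
      and SS: "\<And>x. S (S x) = cadjoint A (A x)"
    using selfadjoint_root[OF A] by blast
  have "norm (S x) = norm (A x)" for x
  proof -
    have "cinner (S x) (S x) = cinner (A x) (A x)"
      unfolding Ssym SS by (simp add: cadjoint[OF A])
    then show ?thesis
      by (simp add: cinner_self flip: of_real_power)
  qed
  from partial_isometry[OF S A this] obtain V W where V: "bounded_clinear V"
      and adj: "\<And>x y. cinner (V x) y = cinner x (W y)"
      and VS: "\<And>x. V (S x) = A x" and WA: "\<And>x. W (A x) = S x"
      and V0: "\<And>p. (\<And>x. cinner p (S x) = 0) \<Longrightarrow> V p = 0"
    by blast
  have adj': "cinner (W x) y = cinner x (V y)" for x y
    by (metis adj cinner_commute)
  have W: "bounded_clinear W"
    using bounded_linear.pos_bounded[OF bounded_clinearD(1)[OF V]]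
      bounded_clinear_adjoint_pair(1)[of V W, OF adj] by (metis less_imp_le mult.commute)
  note lin = linear_add[OF bounded_clinearD(2)] linear_diff[OF bounded_clinearD(2)]
    linear_0[OF bounded_clinearD(2)] bounded_clinearD(3)
  note V_lin = lin[OF V] and W_lin = lin[OF W] and S_lin = lin[OF S]
  \<comment> \<open>W V acts as the projection onto the closed range of S: the remainder is
    orthogonal to that range, and V therefore annihilates it.\<close>
  have compl: "cinner (x - W (V x)) (S z) = 0" for x z
    by (simp add: cinner_simps adj adj' VS WA)
  have VWV: "V (W (V x)) = V x" for x
    using V0[OF compl, of x] by (simp add: V_lin)
  have WVW: "W (V (W x)) = W x" for x
    by (rule cinner_eqI) (simp add: adj adj' VWV)
  have SWV: "S (W (V x)) = S x" for x
  proof -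
    have "S (x - W (V x)) = 0"
      by (rule cinner_eqI) (simp add: Ssym compl)
    then show ?thesis
      by (simp add: S_lin)
  qed
  obtain K where K: "conjugation K" and KS: "\<And>x. K (S x) = S (K x)"
    using conjugation_commuting[OF S Ssym] by blast
  \<comment> \<open>The final projection V W is self-adjoint, so it can take the role of S in
    \<open>conjugation_commuting\<close>; the conjugation L then respects the complement of the
    final space.\<close>
  have "bounded_clinear (\<lambda>x. V (W x))"
    unfolding bounded_clinear_def
    by (intro conjI bounded_linear_compose[of V W] bounded_clinearD(1) V W) (simp add: V_lin W_lin)
  moreover have "cinner (V (W x)) y = cinner x (V (W y))" for x y
    by (simp add: adj adj')
  ultimately obtain L where L: "conjugation L" and LF: "\<And>x. L (V (W x)) = V (W (L x))"
    using conjugation_commuting by blast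
  have conj: "J (x + y) = J x + J y" "J (c *\<^sub>C x) = cnj c *\<^sub>C J x" "J (J x) = x"
      "J (x - y) = J x - J y" "J 0 = 0" if "conjugation J" for J :: "'a \<Rightarrow> 'a" and c x y
  proof -
    show add: "J (x + y) = J x + J y" and "J (c *\<^sub>C x) = cnj c *\<^sub>C J x" "J (J x) = x" for x y c
      using that by (auto simp: conjugation_def)
    show "J (x - y) = J x - J y"
      using add[of "x - y" y] by (simp add: algebra_simps)
    show "J 0 = 0"
      using add[of 0 0] by simp
  qed
  note K_simps = conj[OF K] and L_simps = conj[OF L]
  have KE: "K (W (V x)) = W (V (K x))" for x
  proof -
    \<comment> \<open>Write E for W V. As K commutes with S, it preserves the complement of the
      range of S, which gives E K E = E K. The symmetry of K turns this into E K E = K E, so K and E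
      commute.\<close>
    have EKE: "W (V (K (W (V x)))) = W (V (K x))" for x
    proof -
      have "V (K (x - W (V x))) = 0"
      proof (rule V0)
        fix z
        show "cinner (K (x - W (V x))) (S z) = 0"
          using compl[of x "K z"]
          by (metis conjugation_cinner[OF K] KS cinner_commute complex_cnj_zero)
      qed
      then show ?thesis
        by (simp add: K_simps V_lin)
    qed
    show ?thesis
    proof (rule cinner_eqI)
      fix y
      have "cinner (K (W (V x))) y = cinner (K y) (W (V x))"
        by (rule conjugation_cinner[OF K])
      also have "\<dots> = cinner (W (V (K (W (V y))))) x"
        by (simp add: EKE adj adj')
      also have "\<dots> = cinner (K (W (V y))) (W (V x))"
        by (simp add: adj adj')
      also have "\<dots> = cinner (K (W (V x))) (W (V y))"
        by (rule conjugation_cinner[OF K])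
      also have "\<dots> = cinner (W (V (K (W (V x))))) y"
        by (simp add: adj adj')
      finally show "cinner (K (W (V x))) y = cinner (W (V (K x))) y"
        by (simp add: EKE)
    qed
  qed
  \<comment> \<open>The off-diagonal blocks are V K and K W; the diagonal blocks are L and K on the
    complements of the final and the initial space. K suits the latter because it commutes with W
    V.\<close>
  define J where "J p = (V (K (snd p)) + L (fst p - V (W (fst p))),
    K (W (fst p) + snd p - W (V (snd p))))" for p
  have JJ: "J (J p) = p" for p
    by (cases p) (simp add: J_def V_lin W_lin K_simps L_simps VWV WVW LF KE)
  \<comment> \<open>Combined with J (J p) = p, this symmetry yields that J is isometric.\<close>
  have Jsym: "cinner (J p) q = cinner (J q) p" for p q
  proof -
    have 1: "cinner (V (K y)) a = cinner (K (W a)) y" for y a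
      by (simp add: adj conjugation_cinner[OF K])
    have 2: "cinner (L (x - V (W x))) a = cinner (L (a - V (W a))) x" for x a
      unfolding L_simps LF
      by (simp add: cinner_simps adj adj' conjugation_cinner[OF L, of x a])
        (metis LF adj adj' conjugation_cinner[OF L])
    have 3: "cinner (K (y - W (V y))) b = cinner (K (b - W (V b))) y" for y b
      unfolding K_simps KE
      by (simp add: cinner_simps adj adj' conjugation_cinner[OF K, of y b])
        (metis KE adj adj' conjugation_cinner[OF K])
    have J: "J p = (V (K (snd p)) + L (fst p - V (W (fst p))),
        K (W (fst p)) + K (snd p - W (V (snd p))))" for p
      by (simp add: J_def K_simps)
    show ?thesis
      unfolding J cinner_prod_def
      by (simp add: cinner_add_left 1[of _ "fst _"] 2[of "fst p"] 3[of "snd p"])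
  qed
  have "conjugation J"
    unfolding conjugation_def
  proof (intro conjI allI)
    show "J (x + y) = J x + J y" for x y
      by (simp add: J_def V_lin W_lin K_simps L_simps)
    show "J (c *\<^sub>C x) = cnj c *\<^sub>C J x" for c x
      by (simp add: J_def V_lin W_lin K_simps L_simps scaleC_prod_def scaleC_add_right scaleC_diff_right)
    show "norm (J x) = norm x" for x
    proof -
      have "cinner (J x) (J x) = cinner x x"
        using Jsym[of x "J x"] by (simp add: JJ)
      then show ?thesis
        by (simp add: cinner_self flip: of_real_power)
    qed
  qed (rule JJ)
  moreover have "?T = J \<circ> cadjoint ?T \<circ> J"
  proof -
    have A': "cinner (A x) y = cinner x (S (W y))" for x y
      by (simp add: adj Ssym flip: VS)
    have cadj: "cadjoint ?T = (\<lambda>p. (0, S (W (fst p))))"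
      by (rule cadjointI) (auto simp: cinner_prod_def A')
    have WVS: "W (V (S x)) = S x" for x
      by (simp add: VS WA)
    \<comment> \<open>The adjoint of T sees only W applied to the first component of J p, and W
      kills the part contributed by L.\<close>
    have WJ: "W (fst (J p)) = K (W (V (snd p)))" for p
      by (simp add: J_def W_lin V_lin L_simps LF WVW KE)
    have "J (0, S x) = (V (K (S x)), 0)" for x
      by (simp add: J_def V_lin W_lin K_simps L_simps WVS)
    then have "J (cadjoint ?T (J p)) = (V (K (S (K (W (V (snd p)))))), 0)" for p
      by (simp only: cadj WJ)
    moreover have "V (K (S (K (W (V y))))) = A y" for y
      by (simp add: KS[symmetric] K_simps SWV VS)
    ultimately show ?thesis
      by (simp add: fun_eq_iff)
  qed
  moreover have "bounded_clinear ?T"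
  proof -
    obtain C where C: "\<And>x. norm (A x) \<le> C * norm x" "C > 0"
      using bounded_linear.pos_bounded[OF bounded_clinearD(1)[OF A]] by (metis mult.commute)
    have "norm (?T p) \<le> C * norm p" for p
      using order_trans[OF C(1) mult_left_mono[OF norm_snd_le[of "snd p" "fst p"] less_imp_le[OF C(2)]]]
      by (simp add: case_prod_beta)
    then show ?thesis
      by (rule bounded_clinearI[rotated 2]) (auto simp: lin[OF A] scaleC_prod_def linear_0[OF bounded_linear.linear[OF bounded_linear_scaleC]])
  qed
  ultimately show ?thesis
    by (auto simp: complex_symmetric_def)
qed

section \<open>A criterion for compactness\<close>

lemma orthonormal_expansion:
  fixes E :: "'a::complex_inner set"
  assumes E: "finite E" "\<And>e e'. e \<in> E \<Longrightarrow> e' \<in> E \<Longrightarrow> cinner e e' = (if e = e' then 1 else 0)"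
  defines "r \<equiv> \<lambda>y. y - (\<Sum>e\<in>E. cinner y e *\<^sub>C e)"
  shows "e \<in> E \<Longrightarrow> cinner (r y) e = 0" "norm (r y) \<le> norm y"
proof -
  show orth: "cinner (r y) e = 0" if "e \<in> E" for e
  proof -
    have "cinner (\<Sum>e'\<in>E. cinner y e' *\<^sub>C e') e = (\<Sum>e'\<in>E. if e' = e then cinner y e' else 0)"
      using that by (auto simp: cinner_sum_left cinner_scaleC_left E(2) intro!: sum.cong)
    then show ?thesis
      using that E(1) by (simp add: r_def cinner_diff_left)
  qed
  have "cinner (\<Sum>e\<in>E. cinner y e *\<^sub>C e) (r y) = (\<Sum>e\<in>E. 0)"
    unfolding cinner_sum_left
  proof (rule sum.cong)
    fix e assume "e \<in> E"
    then show "cinner (cinner y e *\<^sub>C e) (r y) = 0"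
      using orth[of e] cinner_commute[of e "r y"] by (simp add: cinner_scaleC_left)
  qed simp
  then have "cinner (r y) (r y) = cinner y (r y)"
    by (subst (1) r_def) (simp add: cinner_diff_left)
  then have "inner (r y) (r y) = inner y (r y)"
    by (metis Re_cinner)
  then have "(norm (r y))\<^sup>2 \<le> norm y * norm (r y)"
    using norm_cauchy_schwarz[of y "r y"] by (simp only: power2_norm_eq_inner)
  then show "norm (r y) \<le> norm y"
    by (cases "norm (r y) = 0") (auto simp: power2_eq_square)
qed

text \<open>Phrased with annihilators instead of spans, since finite codimension is given by
  orthogonality conditions: those imposed by E imply those imposed by F.\<close>

lemma Gram_Schmidt:
  fixes F :: "'a::complex_inner set"
  assumes "finite F"
  shows "\<exists>E. finite E \<and> (\<forall>e\<in>E. \<forall>e'\<in>E. cinner e e' = (if e = e' then 1 else 0)) \<and>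
    (\<forall>y. (\<forall>e\<in>E. cinner y e = 0) \<longrightarrow> (\<forall>h\<in>F. cinner y h = 0))"
  using assms
proof induction
  case empty
  then show ?case
    by (intro exI[of _ "{}"]) simp
next
  case (insert h F)
  from insert.IH obtain E where E: "finite E"
    and on: "\<forall>e\<in>E. \<forall>e'\<in>E. cinner e e' = (if e = e' then 1 else 0)"
    and F: "\<forall>y. (\<forall>e\<in>E. cinner y e = 0) \<longrightarrow> (\<forall>h\<in>F. cinner y h = 0)"
    by (elim exE conjE)
  note on' = on[rule_format]
  define s where "s = (\<Sum>e\<in>E. cinner h e *\<^sub>C e)"
  have hs: "cinner (h - s) e = 0" "cinner e (h - s) = 0" if "e \<in> E" for e
    using orthonormal_expansion(1)[OF E on' that, of h] cinner_commute[of e "h - s"]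
    by (simp_all add: s_def)
  have ys: "cinner y s = 0" if "\<And>e. e \<in> E \<Longrightarrow> cinner y e = 0" for y
  proof -
    have "cinner s y = 0"
      using that unfolding s_def cinner_sum_left
      by (intro sum.neutral) (metis cinner_scaleC_left cinner_commute complex_cnj_zero mult_zero_right)
    then show ?thesis
      by (metis cinner_commute complex_cnj_zero)
  qed
  show ?case
  proof (cases "h = s")
    case True
    then show ?thesis
      using E on F ys by (intro exI[of _ E]) auto
  next
    case False
    define e0 where "e0 = (1 / norm (h - s)) *\<^sub>R (h - s)"
    have "cinner e0 e0 = 1"
      using False by (simp add: e0_def cinner_scaleR_left cinner_scaleR_right cinner_self power2_eq_square)
    moreover have "cinner e0 e = 0" "cinner e e0 = 0" if "e \<in> E" for e
      using hs[OF that] by (simp_all add: e0_def cinner_scaleR_left cinner_scaleR_right)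
    moreover from this have "e0 \<notin> E"
      using calculation(1) by force
    moreover have "cinner y h = 0" if "cinner y e0 = 0" "\<And>e. e \<in> E \<Longrightarrow> cinner y e = 0" for y
      using that(1) ys[OF that(2)] False by (simp add: e0_def cinner_scaleR_right cinner_diff_right)
    ultimately show ?thesis
      using E on F by (intro exI[of _ "insert e0 E"]) auto
  qed
qed

text \<open>A sum of finitely many compact discs is compact. Applied to the vectors A e, it captures
  the finite-dimensional part of the image of the unit ball.\<close>

lemma compact_span_bounded:
  fixes v :: "'i \<Rightarrow> 'a::complex_inner"
  assumes "finite E"
  shows "\<exists>K. compact K \<and> (\<forall>a. (\<forall>e\<in>E. cmod (a e) \<le> 1) \<longrightarrow> (\<Sum>e\<in>E. a e *\<^sub>C v e) \<in> K)"
  using assms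
proof induction
  case empty
  then show ?case
    by (intro exI[of _ "{0}"]) simp
next
  case (insert e E)
  then obtain K where K: "compact K"
      "\<And>a. (\<And>e. e \<in> E \<Longrightarrow> cmod (a e) \<le> 1) \<Longrightarrow> (\<Sum>e\<in>E. a e *\<^sub>C v e) \<in> K"
    by blast
  have "bounded_linear (\<lambda>c. c *\<^sub>C v e)"
    by (rule bounded_linear_intro[where K = "norm (v e)"])
      (simp_all add: scaleC_add_left norm_scaleC scaleR_conv_of_real
        flip: scaleC_of_real scaleC_scaleC)
  then have "compact ((\<lambda>c. c *\<^sub>C v e) ` cball 0 1)"
    by (intro compact_continuous_image linear_continuous_on compact_cball)
  from compact_sums[OF this K(1)]
  show ?case
  proof (intro exI conjI allI impI)
    fix a assume a: "\<forall>e\<in>insert e E. cmod (a e) \<le> 1"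
    then have "a e *\<^sub>C v e \<in> (\<lambda>c. c *\<^sub>C v e) ` cball 0 1" "(\<Sum>e\<in>E. a e *\<^sub>C v e) \<in> K"
      using K(2)[of a] by auto
    then show "(\<Sum>e\<in>insert e E. a e *\<^sub>C v e)
        \<in> {x + y |x y. x \<in> (\<lambda>c. c *\<^sub>C v e) ` cball 0 1 \<and> y \<in> K}"
      using insert.hyps by auto
  qed
qed

text \<open>Total boundedness: split y in the unit ball into its part s in a finite-dimensional
  space and the orthogonal rest. A s lies in a compact set with a finite \<epsilon> / 4 net and A (y
  - s) has norm at most \<epsilon> / 4; the remaining \<epsilon> / 2 pays for the closure.\<close>

lemma compact_operatorI:
  fixes A :: "'a::complex_inner \<Rightarrow> 'b::complex_hilbert"
  assumes A: "bounded_clinear A"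
    and small: "\<And>\<epsilon>. \<epsilon> > 0 \<Longrightarrow> \<exists>F. finite F \<and> (\<forall>y. (\<forall>h\<in>F. cinner y h = 0) \<longrightarrow> norm (A y) \<le> \<epsilon> * norm y)"
  shows "compact_operator A"
proof -
  have "\<exists>T. finite T \<and> closure (A ` cball 0 1) \<subseteq> (\<Union>x\<in>T. ball x \<epsilon>)" if "\<epsilon> > 0" for \<epsilon> :: real
  proof -
    have "\<epsilon> / 4 > 0"
      using that by simp
    from small[OF this] obtain F where F: "finite F"
        "\<forall>y. (\<forall>h\<in>F. cinner y h = 0) \<longrightarrow> norm (A y) \<le> \<epsilon> / 4 * norm y"
      by (elim exE conjE)
    from Gram_Schmidt[OF F(1)] obtain E where E: "finite E"
      and on: "\<forall>e\<in>E. \<forall>e'\<in>E. cinner e e' = (if e = e' then 1 else 0)"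
      and EF: "\<forall>y. (\<forall>e\<in>E. cinner y e = 0) \<longrightarrow> (\<forall>h\<in>F. cinner y h = 0)"
      by (elim exE conjE)
    note on = on[rule_format]
    from compact_span_bounded[OF E, of A] obtain K where K: "compact K"
        "\<forall>a. (\<forall>e\<in>E. cmod (a e) \<le> 1) \<longrightarrow> (\<Sum>e\<in>E. a e *\<^sub>C A e) \<in> K"
      by (elim exE conjE)
    obtain T where T: "finite T" "K \<subseteq> (\<Union>x\<in>T. ball x (\<epsilon> / 4))"
      using K(1) \<open>\<epsilon> / 4 > 0\<close> unfolding compact_eq_totally_bounded by blast
    have near: "\<exists>x\<in>T. dist x (A y) < \<epsilon> / 2" if y: "norm y \<le> 1" for y
    proof -
      define s where "s = (\<Sum>e\<in>E. cinner y e *\<^sub>C e)"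
      have "cinner (y - s) e = 0" if "e \<in> E" for e
        unfolding s_def by (rule orthonormal_expansion(1)[OF E on that])
      then have "norm (A (y - s)) \<le> \<epsilon> / 4 * norm (y - s)"
        using EF F(2) by blast
      moreover have "norm (y - s) \<le> 1"
        using orthonormal_expansion(2)[OF E on, of y] y unfolding s_def by linarith
      ultimately have "norm (A (y - s)) \<le> \<epsilon> / 4"
        using mult_left_mono[of "norm (y - s)" 1 "\<epsilon> / 4"] \<open>\<epsilon> > 0\<close> by linarith
      then have le: "norm (A y - A s) \<le> \<epsilon> / 4"
        by (simp add: linear_diff[OF bounded_clinearD(2)[OF A]])
      have As: "A s = (\<Sum>e\<in>E. cinner y e *\<^sub>C A e)"
        unfolding s_def by (simp add: linear_sum[OF bounded_clinearD(2)[OF A]] bounded_clinearD(3)[OF A])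
      have "cmod (cinner y e) \<le> 1" if "e \<in> E" for e
      proof -
        have "complex_of_real ((norm e)\<^sup>2) = 1"
          using on[OF that that] by (simp add: cinner_self)
        then have "norm e = 1"
          by (metis norm_ge_zero of_real_eq_1_iff real_sqrt_one real_sqrt_unique)
        then show ?thesis
          using cinner_bound[of y e] y by simp
      qed
      then have "A s \<in> K"
        unfolding As by (rule K(2)[rule_format])
      then obtain x where "x \<in> T" "dist x (A s) < \<epsilon> / 4"
        using T(2) by auto
      moreover have "dist x (A y) \<le> dist x (A s) + dist (A y) (A s)"
        by (metis dist_triangle dist_commute)
      ultimately show ?thesis
        using le by (intro bexI[of _ x]) (auto simp: dist_norm)
    qed
    have "z \<in> (\<Union>x\<in>T. ball x \<epsilon>)" if z: "z \<in> closure (A ` cball 0 1)" for z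
    proof -
      obtain y where "norm y \<le> 1" "dist (A y) z < \<epsilon> / 2"
        using z \<open>\<epsilon> > 0\<close> half_gt_zero[of \<epsilon>] unfolding closure_approachable by fastforce
      moreover obtain x where "x \<in> T" "dist x (A y) < \<epsilon> / 2"
        using near calculation(1) by blast
      ultimately show ?thesis
        using dist_triangle[of x z "A y"] by force
    qed
    then show ?thesis
      using T(1) by blast
  qed
  then show ?thesis
    using A unfolding compact_operator_def compact_eq_totally_bounded
    by (simp add: complete_eq_closed)
qed

section \<open>Multiplication operators and model spaces\<close>

lemma integral_circle_powi:
  assumes "n \<noteq> 0"
  shows "(\<integral>z. z powi n \<partial>circle) = 0"
proof -
  have cont: "continuous_on (sphere 0 1) (\<lambda>z :: complex. z powi n)"
    by (intro continuous_intros) auto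
  have [measurable]: "(\<lambda>t. cis t powi n) \<in> borel_measurable borel"
    unfolding cis_power_int by (intro borel_measurable_continuous_onI continuous_intros)
  have "(\<integral>z. z powi n \<partial>circle) = (\<integral>t. cis t powi n \<partial>uniform_measure lborel {0..<2 * pi})"
    unfolding circle_def
    using continuous_on_measurable_circle[OF cont]
    by (intro integral_distr cis_measurable_circle) (simp add: measurable_cong_sets[OF sets_circle refl])
  also have "uniform_measure lborel {0..<2 * pi}
      = density lborel (\<lambda>t. ennreal (indicator {0..<2 * pi} t / (2 * pi)))"
    unfolding uniform_measure_def
    by (intro density_cong) (use divide_ennreal[of 1 "2 * pi"] in \<open>auto split: split_indicator\<close>)
  also have "(\<integral>t. cis t powi n \<partial>\<dots>)
      = (\<integral>t. (indicator {0..<2 * pi} t / (2 * pi)) *\<^sub>R cis t powi n \<partial>lborel)"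
    by (rule integral_density) auto
  also have "\<dots> = (\<integral>t. (1 / (2 * pi)) *\<^sub>R (indicator {0..<2 * pi} t *\<^sub>R cis (real_of_int n * t)) \<partial>lborel)"
    by (simp add: cis_power_int)
  also have "\<dots> = (1 / (2 * pi)) *\<^sub>R (LBINT t=0..2 * pi. cis (real_of_int n * t))"
    by (subst integral_scaleR_right)
      (simp add: interval_integral_Ico set_lebesgue_integral_def zero_ereal_def)
  also have "(LBINT t=0..2 * pi. cis (real_of_int n * t))
      = cis (real_of_int n * (2 * pi)) / (\<i> * of_int n) - cis (real_of_int n * 0) / (\<i> * of_int n)"
    unfolding zero_ereal_def
  proof (rule interval_integral_FTC_finite)
    show "continuous_on {min 0 (2 * pi)..max 0 (2 * pi)} (\<lambda>t. cis (real_of_int n * t))"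
      by (intro continuous_intros)
    show "((\<lambda>t. cis (real_of_int n * t) / (\<i> * of_int n)) has_vector_derivative cis (real_of_int n * x))
        (at x within {min 0 (2 * pi)..max 0 (2 * pi)})" for x
    proof -
      have "((\<lambda>z. exp (\<i> * of_int n * z) / (\<i> * of_int n)) has_field_derivative
          exp (\<i> * of_int n * of_real x)) (at (of_real x))"
        using assms by (auto intro!: derivative_eq_intros)
      from has_vector_derivative_real_field[OF this] show ?thesis
        by (simp add: cis_conv_exp mult.assoc)
    qed
  qed
  also have "cis (real_of_int n * (2 * pi)) = 1"
    by (metis cis_multiple_2pi Ints_of_int mult.commute mult.left_commute)
  finally show ?thesis
    by simp
qed

lemma continuous_on_sq_integrable:
  assumes "continuous_on (sphere 0 1) f"
  shows "sq_integrable f"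
proof -
  have "sq_integrable (\<lambda>z. 1)"
    by (simp add: sq_integrable_def)
  from sq_integrable_Linfty_mult[OF continuous_on_Linfty[OF assms] this] show ?thesis
    by simp
qed

lemma L2_mult_add:
  assumes "\<phi> \<in> Linfty"
  shows "L2_mult \<phi> (f + g) = L2_mult \<phi> f + L2_mult \<phi> g"
  using assms by transfer (auto simp: L2_rel_def sq_integrable_add sq_integrable_Linfty_mult distrib_left)

lemma L2_mult_scaleC:
  assumes "\<phi> \<in> Linfty"
  shows "L2_mult \<phi> (c *\<^sub>C f) = c *\<^sub>C L2_mult \<phi> f"
  using assms by transfer (auto simp: L2_rel_def sq_integrable_scale sq_integrable_Linfty_mult mult.left_commute)

lemma L2_mult_symbol_add:
  assumes "continuous_on (sphere 0 1) p" "continuous_on (sphere 0 1) q"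
  shows "L2_mult (\<lambda>z. p z + q z) f = L2_mult p f + L2_mult q f"
proof -
  have "p \<in> Linfty" "q \<in> Linfty" "(\<lambda>z. p z + q z) \<in> Linfty"
    using assms by (auto intro!: continuous_on_Linfty continuous_intros)
  then show ?thesis
    by transfer (auto simp: L2_rel_def sq_integrable_add sq_integrable_Linfty_mult distrib_right)
qed

lemma L2_mult_const: "L2_mult (\<lambda>z. c) f = c *\<^sub>C f"
proof -
  have "(\<lambda>z. c) \<in> Linfty"
    by (auto intro!: continuous_on_Linfty)
  then show ?thesis
    by transfer (auto simp: L2_rel_def sq_integrable_scale)
qed

lemma L2_mult_mult:
  assumes "continuous_on (sphere 0 1) p" "continuous_on (sphere 0 1) q"
  shows "L2_mult (\<lambda>z. p z * q z) f = L2_mult p (L2_mult q f)"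
proof -
  have "p \<in> Linfty" "q \<in> Linfty" "(\<lambda>z. p z * q z) \<in> Linfty"
    using assms by (auto intro!: continuous_on_Linfty continuous_intros)
  then show ?thesis
    by transfer (auto simp: L2_rel_def sq_integrable_Linfty_mult mult.assoc)
qed

lemma L2_mult_commute:
  assumes "\<phi> \<in> Linfty" "\<psi> \<in> Linfty"
  shows "L2_mult \<phi> (L2_mult \<psi> f) = L2_mult \<psi> (L2_mult \<phi> f)"
  using assms by transfer (auto simp: L2_rel_def sq_integrable_Linfty_mult mult.left_commute)

lemma L2_mult_class:
  assumes "\<phi> \<in> Linfty" "sq_integrable f"
  shows "L2_mult \<phi> (L2_class f) = L2_class (\<lambda>z. \<phi> z * f z)"
  using assms by transfer (auto simp: L2_rel_def sq_integrable_Linfty_mult)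

lemma L2_class_cong:
  assumes "continuous_on (sphere 0 1) f" "\<And>z. cmod z = 1 \<Longrightarrow> f z = g z"
  shows "L2_class f = L2_class g"
proof -
  have "sq_integrable f" "sq_integrable g"
    using assms continuous_on_cong[of "sphere 0 1" "sphere 0 1" f g]
    by (auto intro!: continuous_on_sq_integrable)
  then show ?thesis
    using assms(2) by transfer (auto simp: L2_rel_def intro!: AE_I2)
qed

lemma cinner_L2_class:
  assumes "sq_integrable f" "sq_integrable g"
  shows "cinner (L2_class f) (L2_class g) = (\<integral>z. f z * cnj (g z) \<partial>circle)"
  using assms by transfer simp

lemma cinner_L2_mult:
  assumes "continuous_on (sphere 0 1) q"
  shows "cinner (L2_mult q f) g = cinner f (L2_mult (\<lambda>z. cnj (q z)) g)"
proof -
  have "q \<in> Linfty" "(\<lambda>z. cnj (q z)) \<in> Linfty"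
    using assms by (auto intro!: continuous_on_Linfty continuous_intros)
  then show ?thesis
    by transfer (simp add: mult_ac)
qed

lemma L2_mult_cancel:
  assumes "continuous_on (sphere 0 1) p" "continuous_on (sphere 0 1) q"
    and "\<And>z. cmod z = 1 \<Longrightarrow> p z * q z = 1"
  shows "L2_mult p (L2_mult q f) = f"
proof -
  have "p \<in> Linfty" "q \<in> Linfty"
    using assms by (auto intro!: continuous_on_Linfty)
  then show ?thesis
    by (transfer fixing: p q)
      (clarsimp simp: L2_rel_def sq_integrable_Linfty_mult, rule AE_I2, simp add: assms(3))
qed

lemma norm_L2_mult_le:
  assumes q: "continuous_on (sphere 0 1) q" and C: "\<And>z. cmod z = 1 \<Longrightarrow> cmod (q z) \<le> C"
  shows "norm (L2_mult q f) \<le> C * norm f"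
proof -
  have C0: "C \<ge> 0"
    using order_trans[OF norm_ge_zero C[of 1]] by simp
  have q': "q \<in> Linfty"
    using q by (rule continuous_on_Linfty)
  have "Re (\<integral>z. q z * f z * cnj (q z * f z) \<partial>circle) \<le> C\<^sup>2 * Re (\<integral>z. f z * cnj (f z) \<partial>circle)"
    if f: "sq_integrable f" for f
  proof -
    have eq: "Re (\<integral>z. g z * cnj (g z) \<partial>circle) = (\<integral>z. (cmod (g z))\<^sup>2 \<partial>circle)" for g
      by (simp add: complex_norm_square[symmetric] del: of_real_power)
    have "(\<integral>z. (cmod (q z * f z))\<^sup>2 \<partial>circle) \<le> (\<integral>z. C\<^sup>2 * (cmod (f z))\<^sup>2 \<partial>circle)"
    proof (rule integral_mono)
      show "integrable circle (\<lambda>z. (cmod (q z * f z))\<^sup>2)"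
        using sq_integrable_Linfty_mult[OF q' f] by (simp add: sq_integrable_def)
      show "integrable circle (\<lambda>z. C\<^sup>2 * (cmod (f z))\<^sup>2)"
        using f by (simp add: sq_integrable_def)
      show "(cmod (q z * f z))\<^sup>2 \<le> C\<^sup>2 * (cmod (f z))\<^sup>2" if "z \<in> space circle" for z
        using that C[of z] by (auto simp: norm_mult power_mult_distrib intro!: mult_right_mono power_mono)
    qed
    then show ?thesis
      unfolding eq by simp
  qed
  with q' have "Re (cinner (L2_mult q f) (L2_mult q f)) \<le> C\<^sup>2 * Re (cinner f f)"
    by transfer (simp add: L2_rel_def)
  then have "(norm (L2_mult q f))\<^sup>2 \<le> (C * norm f)\<^sup>2"
    by (simp only: Re_cinner power2_norm_eq_inner[symmetric] power_mult_distrib)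
  then show ?thesis
    by (rule power2_le_imp_le) (use C0 in simp)
qed

section \<open>Monomials, the bilateral shift and the Hardy space\<close>

abbreviation monomial :: "int \<Rightarrow> L2" where
  "monomial n \<equiv> L2_class (\<lambda>z. z powi n)"

lemma continuous_on_powi_circle: "continuous_on (sphere 0 1) (\<lambda>z :: complex. z powi n)"
  by (intro continuous_intros) auto

lemma cnj_on_circle: "cmod z = 1 \<Longrightarrow> cnj z = inverse z"
  using complex_norm_square[of z] by (intro inverse_unique[symmetric]) simp

lemma shift_backward_shift:
  "L2_mult (\<lambda>z. z) (L2_mult cnj f) = f" "L2_mult cnj (L2_mult (\<lambda>z. z) f) = f"
proof -
  have "z * cnj z = 1" "cnj z * z = 1" if "cmod z = 1" for z
    using that by (simp_all add: mult.commute[of "cnj z"] flip: complex_norm_square)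
  then show "L2_mult (\<lambda>z. z) (L2_mult cnj f) = f" "L2_mult cnj (L2_mult (\<lambda>z. z) f) = f"
    by (intro L2_mult_cancel continuous_on_cnj continuous_on_id; simp)+
qed

lemma shift_monomial: "L2_mult (\<lambda>z. z) (monomial n) = monomial (n + 1)"
proof -
  have "L2_mult (\<lambda>z. z) (monomial n) = L2_class (\<lambda>z. z * z powi n)"
    by (intro L2_mult_class continuous_on_Linfty continuous_on_sq_integrable
        continuous_on_powi_circle continuous_on_id)
  also have "\<dots> = monomial (n + 1)"
  proof (rule L2_class_cong)
    show "z * z powi n = z powi (n + 1)" if "cmod z = 1" for z :: complex
      using that by (subst power_int_add_1) auto
  qed (intro continuous_on_mult continuous_on_id continuous_on_powi_circle)
  finally show ?thesis .
qed

lemma backward_shift_monomial: "L2_mult cnj (monomial n) = monomial (n - 1)"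
  using shift_backward_shift(2)[of "monomial (n - 1)"] by (simp add: shift_monomial)

lemma cinner_monomial: "cinner (monomial m) (monomial n) = (if m = n then 1 else 0)"
proof -
  have "cinner (monomial m) (monomial n) = (\<integral>z. z powi m * cnj (z powi n) \<partial>circle)"
    by (intro cinner_L2_class continuous_on_sq_integrable continuous_on_powi_circle)
  also have "\<dots> = (\<integral>z. z powi (m - n) \<partial>circle)"
  proof (rule Bochner_Integration.integral_cong)
    fix z assume "z \<in> space circle"
    then have "cmod z = 1" "z \<noteq> 0"
      by auto
    moreover from this have "cnj (z powi n) = inverse (z powi n)"
      by (intro cnj_on_circle) (simp add: norm_power_int)
    ultimately show "z powi m * cnj (z powi n) = z powi (m - n)"
      by (simp add: power_int_diff divide_inverse)
  qed simp
  also have "\<dots> = (if m = n then 1 else 0)"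
  proof -
    have "measure circle (sphere 0 1) = 1"
      using emeasure_circle by (simp add: circle.emeasure_eq_measure)
    then show ?thesis
      by (auto simp: integral_circle_powi)
  qed
  finally show ?thesis .
qed

lemma cinner_shift: "cinner (L2_mult (\<lambda>z. z) f) g = cinner f (L2_mult cnj g)"
  and cinner_backward_shift: "cinner (L2_mult cnj f) g = cinner f (L2_mult (\<lambda>z. z) g)"
  using cinner_L2_mult[of "\<lambda>z. z" f g] cinner_L2_mult[of cnj f g] by (simp_all add: continuous_intros)

lemma Linfty_shift: "(\<lambda>z. z) \<in> Linfty" "cnj \<in> Linfty"
  by (auto intro!: continuous_on_Linfty continuous_intros)

text \<open>This separates the constant term, so that orthogonality to u H2 can be checked on u and
  on z u H2 separately.\<close>

lemma H2_decompose:
  assumes "g \<in> H2"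
  obtains c h where "h \<in> H2" "g = c *\<^sub>C monomial 0 + L2_mult (\<lambda>z. z) h"
proof -
  define c where "c = cinner g (monomial 0)"
  define h where "h = L2_mult cnj (g - c *\<^sub>C monomial 0)"
  have "cinner h (monomial n) = 0" if "n < 0" for n
  proof -
    have "cinner h (monomial n) = cinner (g - c *\<^sub>C monomial 0) (monomial (n + 1))"
      unfolding h_def by (simp only: cinner_backward_shift shift_monomial)
    also have "\<dots> = cinner g (monomial (n + 1)) - c * (if 0 = n + 1 then 1 else 0)"
      by (simp only: cinner_diff_left cinner_scaleC_left cinner_monomial)
    also have "\<dots> = 0"
    \<comment> \<open>At n = -1 the shifted index is 0, and the subtracted constant term cancels
      exactly this coefficient.\<close>
    proof (cases "n = -1")
      case False
      then have "n + 1 < 0"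
        using that by simp
      then have "cinner g (monomial (n + 1)) = 0"
        using assms by (simp only: H2_def mem_Collect_eq)
      then show ?thesis
        using \<open>n + 1 < 0\<close> by simp
    qed (simp add: c_def)
    finally show ?thesis .
  qed
  then have "h \<in> H2"
    by (simp add: H2_def)
  moreover have "g = c *\<^sub>C monomial 0 + L2_mult (\<lambda>z. z) h"
    unfolding h_def shift_backward_shift by simp
  ultimately show thesis
    using that by blast
qed

section \<open>Model spaces and almost invariant symbols\<close>

lemma inner_function_Linfty: "inner_function u \<Longrightarrow> u \<in> Linfty"
  unfolding inner_function_def Linfty_def
  by (auto intro!: exI[of _ 1] elim!: eventually_mono)

text \<open>Testing z f against u g means testing f against cnj z * u g. For g = c + z h the second
  term gives u h, to which f is already orthogonal, and only the multiple of cnj z * u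
  remains.\<close>

lemma shift_model_space:
  assumes u: "u \<in> Linfty" and f: "f \<in> model_space u"
    and orth: "cinner f (L2_mult cnj (L2_mult u (monomial 0))) = 0"
  shows "L2_mult (\<lambda>z. z) f \<in> model_space u"
proof -
  have "cinner (L2_mult (\<lambda>z. z) f) (monomial n) = 0" if "n < 0" for n
    using f that by (simp add: cinner_shift backward_shift_monomial model_space_def H2_def)
  moreover have "cinner (L2_mult (\<lambda>z. z) f) (L2_mult u g) = 0" if g: "g \<in> H2" for g
  proof -
    obtain c h where h: "h \<in> H2" and g: "g = c *\<^sub>C monomial 0 + L2_mult (\<lambda>z. z) h"
      using H2_decompose[OF g] .
    have "L2_mult cnj (L2_mult u (L2_mult (\<lambda>z. z) h)) = L2_mult u h"
      unfolding L2_mult_commute[OF u Linfty_shift(1)] shift_backward_shift ..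
    moreover have "cinner f (L2_mult u h) = 0"
      using f h by (simp add: model_space_def)
    ultimately show ?thesis
      using orth
      by (simp add: cinner_shift g L2_mult_add L2_mult_scaleC u Linfty_shift
          cinner_add_right cinner_scaleC_right)
  qed
  ultimately show ?thesis
    by (auto simp: model_space_def H2_def)
qed

text \<open>Orthogonality to u H2 survives because z H2 lies in H2; membership in H2 can fail only
  at index -1, where the constant coefficient of f would land.\<close>

lemma backward_shift_model_space:
  assumes u: "u \<in> Linfty" and f: "f \<in> model_space u" and orth: "cinner f (monomial 0) = 0"
  shows "L2_mult cnj f \<in> model_space u"
proof -
  have "cinner (L2_mult cnj f) (monomial n) = 0" if "n < 0" for n
  proof (cases "n = -1")
    case True
    then show ?thesis
      unfolding cinner_backward_shift shift_monomial using orth by simp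
  next
    case False
    then have "n + 1 < 0"
      using that by simp
    then show ?thesis
      unfolding cinner_backward_shift shift_monomial using f by (simp add: model_space_def H2_def)
  qed
  moreover have "cinner (L2_mult cnj f) (L2_mult u g) = 0" if g: "g \<in> H2" for g
  proof -
    have "cinner (L2_mult (\<lambda>z. z) g) (monomial n) = 0" if "n < 0" for n
      using g that by (simp add: cinner_shift backward_shift_monomial H2_def)
    then have "L2_mult (\<lambda>z. z) g \<in> H2"
      by (simp add: H2_def)
    then show ?thesis
      using f
      by (simp add: cinner_backward_shift L2_mult_commute[OF Linfty_shift(1) u] model_space_def)
  qed
  ultimately show ?thesis
    by (auto simp: model_space_def H2_def)
qed

lemma model_space_add:
  assumes "f \<in> model_space u" "g \<in> model_space u"
  shows "f + g \<in> model_space u"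
  using assms by (auto simp: model_space_def H2_def cinner_add_left)

lemma model_space_scaleC:
  assumes "f \<in> model_space u"
  shows "c *\<^sub>C f \<in> model_space u"
  using assms by (auto simp: model_space_def H2_def cinner_scaleC_left)

text \<open>The symbols for which multiplication maps a subspace of finite codimension of the model space
  into the model space. They form an algebra, because \<open>q f\<close> is orthogonal to \<open>F\<close> if and only if \<open>f\<close> is
  orthogonal to the functions \<open>cnj q * h\<close> with \<open>h \<in> F\<close>.\<close>

definition almost_invariant_symbol :: "(complex \<Rightarrow> complex) \<Rightarrow> (complex \<Rightarrow> complex) \<Rightarrow> bool" where
  "almost_invariant_symbol u q \<longleftrightarrow> continuous_on (sphere 0 1) q \<and>
     (\<exists>F. finite F \<and> (\<forall>f\<in>model_space u. (\<forall>h\<in>F. cinner f h = 0) \<longrightarrow> L2_mult q f \<in> model_space u))"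

lemma almost_invariant_symbolI:
  assumes "continuous_on (sphere 0 1) q" "finite F"
    and "\<And>f. f \<in> model_space u \<Longrightarrow> (\<And>h. h \<in> F \<Longrightarrow> cinner f h = 0) \<Longrightarrow> L2_mult q f \<in> model_space u"
  shows "almost_invariant_symbol u q"
  unfolding almost_invariant_symbol_def using assms by (intro conjI exI[of _ F]) auto

lemma almost_invariant_symbol_const: "almost_invariant_symbol u (\<lambda>z. c)"
  by (rule almost_invariant_symbolI[where F = "{}"])
    (simp_all add: L2_mult_const model_space_scaleC)

lemma almost_invariant_symbol_id:
  assumes "u \<in> Linfty"
  shows "almost_invariant_symbol u (\<lambda>z. z)"
  by (rule almost_invariant_symbolI[where F = "{L2_mult cnj (L2_mult u (monomial 0))}"])
    (simp_all add: shift_model_space[OF assms] continuous_on_id)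

lemma almost_invariant_symbol_cnj:
  assumes "u \<in> Linfty"
  shows "almost_invariant_symbol u cnj"
  by (rule almost_invariant_symbolI[where F = "{monomial 0}"])
    (simp_all add: backward_shift_model_space[OF assms] continuous_on_cnj continuous_on_id)

lemma almost_invariant_symbol_add:
  assumes p: "almost_invariant_symbol u p" and q: "almost_invariant_symbol u q"
  shows "almost_invariant_symbol u (\<lambda>z. p z + q z)"
proof -
  from p obtain F where F: "continuous_on (sphere 0 1) p" "finite F"
      "\<forall>f\<in>model_space u. (\<forall>h\<in>F. cinner f h = 0) \<longrightarrow> L2_mult p f \<in> model_space u"
    unfolding almost_invariant_symbol_def by (elim conjE exE)
  from q obtain G where G: "continuous_on (sphere 0 1) q" "finite G"
      "\<forall>f\<in>model_space u. (\<forall>h\<in>G. cinner f h = 0) \<longrightarrow> L2_mult q f \<in> model_space u"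
    unfolding almost_invariant_symbol_def by (elim conjE exE)
  show ?thesis
  proof (rule almost_invariant_symbolI)
    fix f assume "f \<in> model_space u" "\<And>h. h \<in> F \<union> G \<Longrightarrow> cinner f h = 0"
    then show "L2_mult (\<lambda>z. p z + q z) f \<in> model_space u"
      unfolding L2_mult_symbol_add[OF F(1) G(1)] by (intro model_space_add F(3)[rule_format] G(3)[rule_format]) blast+
  qed (use F G in \<open>auto intro: continuous_on_add\<close>)
qed

lemma almost_invariant_symbol_mult:
  assumes p: "almost_invariant_symbol u p" and q: "almost_invariant_symbol u q"
  shows "almost_invariant_symbol u (\<lambda>z. p z * q z)"
proof -
  from p obtain F where F: "continuous_on (sphere 0 1) p" "finite F"
      "\<forall>f\<in>model_space u. (\<forall>h\<in>F. cinner f h = 0) \<longrightarrow> L2_mult p f \<in> model_space u"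
    unfolding almost_invariant_symbol_def by (elim conjE exE)
  from q obtain G where G: "continuous_on (sphere 0 1) q" "finite G"
      "\<forall>f\<in>model_space u. (\<forall>h\<in>G. cinner f h = 0) \<longrightarrow> L2_mult q f \<in> model_space u"
    unfolding almost_invariant_symbol_def by (elim conjE exE)
  show ?thesis
  proof (rule almost_invariant_symbolI)
    fix f assume f: "f \<in> model_space u"
      and orth: "\<And>h. h \<in> L2_mult (\<lambda>z. cnj (q z)) ` F \<union> G \<Longrightarrow> cinner f h = 0"
    have "cinner (L2_mult q f) h = 0" if "h \<in> F" for h
      unfolding cinner_L2_mult[OF G(1)] using that by (intro orth) blast
    moreover have "L2_mult q f \<in> model_space u"
      using f by (rule G(3)[rule_format]) (use orth in blast)
    ultimately show "L2_mult (\<lambda>z. p z * q z) f \<in> model_space u"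
      unfolding L2_mult_mult[OF F(1) G(1)] by (intro F(3)[rule_format])
  qed (use F G in \<open>auto intro: continuous_on_mult\<close>)
qed

text \<open>Polynomials in the real coordinates are generated by constants and real-linear forms,
  and a real-linear form on the plane is a complex combination of z and cnj z.\<close>

lemma almost_invariant_symbol_polynomial:
  assumes u: "u \<in> Linfty" and "real_polynomial_function p"
  shows "almost_invariant_symbol u (\<lambda>z. of_real (p z))"
  using assms(2)
proof induction
  case (linear f)
  \<comment> \<open>These come from f z = Re z * f 1 + Im z * f \<i> with Re z = (z + cnj z) / 2 and
    Im z = (z - cnj z) / (2 \<i>).\<close>
  define a b where "a = (of_real (f 1) - \<i> * of_real (f \<i>)) / 2"
    and "b = (of_real (f 1) + \<i> * of_real (f \<i>)) / 2"
  interpret f: bounded_linear f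
    by fact
  have "of_real (f z) = a * z + b * cnj z" for z
  proof -
    have "Re z *\<^sub>R 1 + Im z *\<^sub>R \<i> = z"
      by (simp add: complex_eq_iff)
    then have "f z = f (Re z *\<^sub>R 1 + Im z *\<^sub>R \<i>)"
      by (simp only:)
    also have "\<dots> = Re z * f 1 + Im z * f \<i>"
      by (simp only: f.add f.scaleR real_scaleR_def)
    finally show ?thesis
      by (simp add: a_def b_def complex_eq_iff field_simps)
  qed
  moreover have "almost_invariant_symbol u (\<lambda>z. a * z + b * cnj z)"
    by (intro almost_invariant_symbol_add almost_invariant_symbol_mult
        almost_invariant_symbol_const almost_invariant_symbol_id almost_invariant_symbol_cnj u)
  ultimately show ?case
    by simp
qed (auto intro: almost_invariant_symbol_const almost_invariant_symbol_add almost_invariant_symbol_mult)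

lemma almost_invariant_symbol_dense:
  assumes u: "u \<in> Linfty" and \<phi>: "continuous_on (sphere 0 1) \<phi>" and "\<epsilon> > 0"
  obtains q where "almost_invariant_symbol u q" "\<And>z. cmod z = 1 \<Longrightarrow> cmod (\<phi> z - q z) \<le> \<epsilon>"
proof -
  obtain q where q: "polynomial_function q" "\<And>z. z \<in> sphere 0 1 \<Longrightarrow> cmod (\<phi> z - q z) < \<epsilon>"
    using Stone_Weierstrass_polynomial_function[OF compact_sphere \<phi> \<open>\<epsilon> > 0\<close>] by blast
  have "real_polynomial_function (Re \<circ> q)" "real_polynomial_function (Im \<circ> q)"
    using q(1) bounded_linear_Re bounded_linear_Im unfolding polynomial_function_def by blast+
  then have "almost_invariant_symbol u (\<lambda>z. of_real ((Re \<circ> q) z) + \<i> * of_real ((Im \<circ> q) z))"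
    by (intro almost_invariant_symbol_add almost_invariant_symbol_mult
        almost_invariant_symbol_const almost_invariant_symbol_polynomial u)
  also have "(\<lambda>z. of_real ((Re \<circ> q) z) + \<i> * of_real ((Im \<circ> q) z)) = q"
    by (auto simp: complex_eq_iff)
  finally show thesis
    using q(2) by (intro that[of q]) (auto intro: less_imp_le)
qed

text \<open>Multiplication operators commute with their adjoints, and a normal operator and its
  adjoint have equal norms on each vector.\<close>

lemma norm_L2_mult_cnj:
  assumes \<phi>: "continuous_on (sphere 0 1) \<phi>"
  shows "norm (L2_mult (\<lambda>z. cnj (\<phi> z)) f) = norm (L2_mult \<phi> f)"
proof -
  have \<psi>: "continuous_on (sphere 0 1) (\<lambda>z. cnj (\<phi> z))"
    using \<phi> by (rule continuous_on_cnj)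
  have "cinner (L2_mult \<phi> f) (L2_mult \<phi> f)
      = cinner f (L2_mult \<phi> (L2_mult (\<lambda>z. cnj (\<phi> z)) f))"
    unfolding cinner_L2_mult[OF \<phi>] L2_mult_commute[OF continuous_on_Linfty continuous_on_Linfty, OF \<phi> \<psi>] ..
  also have "\<dots> = cinner (L2_mult (\<lambda>z. cnj (\<phi> z)) f) (L2_mult (\<lambda>z. cnj (\<phi> z)) f)"
    unfolding cinner_L2_mult[OF \<psi>] by simp
  finally show ?thesis
    by (simp add: cinner_self flip: of_real_power)
qed

section \<open>From unitary equivalence to compactness\<close>

lemma compact_if_truncated_Toeplitz:
  fixes A :: "'a::complex_hilbert \<Rightarrow> 'a"
  assumes A: "bounded_clinear A" and u: "u \<in> Linfty" and \<phi>: "continuous_on (sphere 0 1) \<phi>"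
    and equiv: "unitarily_equivalent_on (\<lambda>(x, y). (A y, 0)) (model_space u) (truncated_Toeplitz u \<phi>)"
  shows "compact_operator A"
proof (rule compact_operatorI[OF A])
  let ?M = "model_space u" and ?\<psi> = "\<lambda>z. cnj (\<phi> z)"
  obtain U :: "'a \<times> 'a \<Rightarrow> L2" where U: "bounded_clinear U" "\<And>x y. cinner (U x) (U y) = cinner x y"
      and range: "range U = ?M" and eq: "\<And>x y. U (A y, 0) = truncated_Toeplitz u \<phi> (U (x, y))"
    using equiv unfolding unitarily_equivalent_on_def unitary_onto_def by auto
  have normU: "norm (U x) = norm x" for x
    using U(2)[of x x] by (simp add: cinner_self flip: of_real_power)
  \<comment> \<open>The model space is the range of the isometry U, from which it inherits being a
    complete subspace.\<close>
  have sub: "subspace ?M"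
    unfolding range[symmetric] by (intro linear_subspace_image bounded_clinearD U subspace_UNIV)
  have "complete ?M"
    unfolding range[symmetric]
    by (rule complete_isometric_image[of 1])
      (auto simp: normU bounded_clinearD[OF U(1)] subspace_UNIV complete_eq_closed)
  note M = sub this
  have Toep: "truncated_Toeplitz u \<phi> f = proj ?M (L2_mult \<phi> f)" for f
    unfolding truncated_Toeplitz_def by (rule orth_proj_eq_proj[OF M model_space_scaleC])
  have \<psi>: "continuous_on (sphere 0 1) ?\<psi>"
    using \<phi> by (rule continuous_on_cnj)
  fix \<epsilon> :: real assume "\<epsilon> > 0"
  then have "\<epsilon> / 2 > 0"
    by simp
  then obtain q where q: "almost_invariant_symbol u q"
      and near: "\<And>z. cmod z = 1 \<Longrightarrow> cmod (?\<psi> z - q z) \<le> \<epsilon> / 2"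
    using almost_invariant_symbol_dense[OF u \<psi>] by blast
  from q obtain F where cont: "continuous_on (sphere 0 1) q" and F: "finite F"
      "\<forall>f\<in>?M. (\<forall>h\<in>F. cinner f h = 0) \<longrightarrow> L2_mult q f \<in> ?M"
    unfolding almost_invariant_symbol_def by (elim conjE exE)
  \<comment> \<open>Orthogonality of U (0, y) to h is orthogonality of y to the second component of
    the adjoint of U at h; this pulls the finitely many conditions back to the original
    space.\<close>
  have "norm (A y) \<le> \<epsilon> * norm y" if y: "\<And>h. h \<in> F \<Longrightarrow> cinner y (snd (cadjoint U h)) = 0" for y
  proof -
    define f where "f = U (0, y)"
    have f: "f \<in> ?M" "norm f = norm y"
      by (simp_all add: f_def normU flip: range)
    have "cinner f h = 0" if "h \<in> F" for h
      using y[OF that] unfolding f_def cadjoint[OF U(1)] by (simp add: cinner_prod_def)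
    then have qf: "L2_mult q f \<in> ?M"
      using F(2) f(1) by blast
    \<comment> \<open>The range of \<open>T\<close> is orthogonal to \<open>(0, y)\<close>, so the adjoint of the Toeplitz operator annihilates \<open>f\<close>.\<close>
    have orth: "cinner (L2_mult ?\<psi> f) k = 0" if k: "k \<in> ?M" for k
    proof -
      obtain a b where k: "k = U (a, b)"
        using k unfolding range[symmetric] by auto
      have "cinner (L2_mult \<phi> k - proj ?M (L2_mult \<phi> k)) f = 0"
        by (rule proj_corth[OF M model_space_scaleC f(1)])
      then have "cinner f (L2_mult \<phi> k) = cinner f (proj ?M (L2_mult \<phi> k))"
        by (metis cinner_commute cinner_diff_left eq_iff_diff_eq_0)
      also have "\<dots> = cinner f (U (A b, 0))"
        unfolding k Toep[symmetric] eq[of b a] ..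
      also have "\<dots> = 0"
        unfolding f_def U(2) by (simp add: cinner_prod_def)
      finally show ?thesis
        by (simp add: cinner_L2_mult[OF \<psi>])
    qed
    \<comment> \<open>d is the approximation error. As q f lies in the model space and d + q f is
      orthogonal to it, the norm of q f is at most that of d, so d + q f has norm at most twice that
      of d. Hence the accuracy \<epsilon> / 2 for q.\<close>
    define d where "d = L2_mult (\<lambda>z. ?\<psi> z + (- 1) * q z) f"
    have neg: "L2_mult (\<lambda>z. (- 1) * q z) f = - L2_mult q f"
      by (subst L2_mult_mult[OF continuous_on_const cont]) (simp only: L2_mult_const scaleC_minus1)
    have d: "L2_mult ?\<psi> f = d + L2_mult q f"
      unfolding d_def neg L2_mult_symbol_add[OF \<psi> continuous_on_mult[OF continuous_on_const cont]]
      by simp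
    have nd: "norm d \<le> \<epsilon> / 2 * norm f"
      unfolding d_def using near
      by (intro norm_L2_mult_le continuous_on_add continuous_on_mult continuous_on_const \<psi> cont) simp
    have "inner d (L2_mult q f) + inner (L2_mult q f) (L2_mult q f) = 0"
      using orth[OF qf] unfolding d by (metis Re_cinner inner_add_left zero_complex.sel(1))
    then have "(norm (L2_mult q f))\<^sup>2 \<le> norm d * norm (L2_mult q f)"
      using Cauchy_Schwarz_ineq2[of d "L2_mult q f"] by (simp add: power2_norm_eq_inner abs_le_iff)
    then have "norm (L2_mult q f) \<le> norm d"
      by (cases "norm (L2_mult q f) = 0") (auto simp: power2_eq_square)
    then have le: "norm (L2_mult ?\<psi> f) \<le> \<epsilon> * norm f"
      unfolding d using norm_triangle_ineq[of d "L2_mult q f"] nd by simp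
    have "norm (A y) = norm (U (A y, 0))"
      by (simp add: normU norm_Pair)
    also have "\<dots> = norm (proj ?M (L2_mult \<phi> f))"
      by (simp only: eq[of y 0] Toep f_def)
    also have "\<dots> \<le> norm (L2_mult \<phi> f)"
      by (rule norm_proj[OF M])
    also have "\<dots> \<le> \<epsilon> * norm f"
      using le by (simp only: norm_L2_mult_cnj[OF \<phi>])
    finally show ?thesis
      by (simp only: f)
  qed
  then show "\<exists>F. finite F \<and> (\<forall>y. (\<forall>h\<in>F. cinner y h = 0) \<longrightarrow> norm (A y) \<le> \<epsilon> * norm y)"
    using F(1) by (intro exI[of _ "(\<lambda>h. snd (cadjoint U h)) ` F"]) simp
qed

theorem corollary2:
  fixes A :: "'a::complex_hilbert \<Rightarrow> 'a" and T :: "'a \<times> 'a \<Rightarrow> 'a \<times> 'a"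
  assumes separable: "\<exists>D :: 'a set. countable D \<and> closure D = UNIV"
    and bounded: "bounded_clinear A"
    and noncompact: "\<not> compact_operator A"
    and T: "T = (\<lambda>(x, y). (A y, 0))"
  shows "complex_symmetric T \<and>
    \<not> (\<exists>u \<phi>. inner_function u \<and> nonconstant u \<and> continuous_on (sphere 0 1) \<phi> \<and>
            unitarily_equivalent_on T (model_space u) (truncated_Toeplitz u \<phi>))"
  using complex_symmetric_off_diagonal[OF bounded] noncompact
    compact_if_truncated_Toeplitz[OF bounded inner_function_Linfty]
  unfolding T by blast

end
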